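(* Let $n\ge 4$ be an integer, let $0<\beta\le\lfloor n/2\rfloor/n$, put $p=\lfloor(2-\beta)n\rfloor$, and let $E(K_{p})=E(R)\cup E(B)$ be a $2$-coloring such that $C_{n}\nsubseteq R$ and $C_{n}\nsubseteq B$. Then there exist a vertex $u\in V(K_{p})$ and a partition $V(K_{p})=U_{1}\cup U_{2}\cup\{u\}$ with $$(1-\beta)n-1<|U_{1}|\le|U_{2}|<n$$ satisfying, up to color, $$E(R-u)=U_{1}^{(2)}\cup U_{2}^{(2)}\quad\text{and}\quad E(B-u)=U_{1}\times U_{2}.$$
   Context: Graphs are finite, simple and undirected. $K_p$ is the complete graph on $p$ vertices, $C_n$ is the cycle of length $n$, and $C_n\subseteq H$ means $H$ contains a (not necessarily induced) subgraph isomorphic to $C_n$. A $2$-coloring of $E(G)$ is a partition $E(G)=E(R)\cup E(B)$ (disjoint union), where $R$ and $B$ are graphs with $V(R)=V(B)=V(G)$. A statement $S(R,B)$ holds "up to color" if either $S(R,B)$ or $S(B,R)$ is true. For a set $A$, $A^{(2)}$ is the family of all $2$-element subsets of $A$; for disjoint vertex sets $A,B$, $A\times B$ denotes the set of all possible (unordered) edges joining a vertex of $A$ to a vertex of $B$. $H-u$ is $H$ with the vertex $u$ deleted. *)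

theory Defs
  imports Complex_Main "HOL-Library.Ramsey"
begin

text \<open>A graph is a pair of a vertex set and a set of edges, each edge a two-element vertex set.
  \<open>[A]\<^bsup>2\<^esup>\<close> is the library's \<^term>\<open>nsets A 2\<close>, the set of all two-element subsets of \<open>A\<close>.\<close>

type_synonym 'a graph = "'a set \<times> 'a set set"

abbreviation verts :: "'a graph \<Rightarrow> 'a set" where
  "verts \<equiv> fst"

abbreviation edges :: "'a graph \<Rightarrow> 'a set set" where
  "edges \<equiv> snd"

definition simple_graph :: "'a graph \<Rightarrow> bool" where
  "simple_graph G \<longleftrightarrow> finite (verts G) \<and> edges G \<subseteq> [verts G]\<^bsup>2\<^esup>"

definition complete_graph :: "'a set \<Rightarrow> 'a graph" where
  "complete_graph V = (V, [V]\<^bsup>2\<^esup>)"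

text \<open>This is the cycle of length \<open>n\<close> only for \<open>n \<ge> 3\<close>.\<close>

definition cycle_graph :: "nat \<Rightarrow> nat graph" where
  "cycle_graph n = ({..<n}, {{i, Suc i mod n} | i. i < n})"

definition subgraph :: "'a graph \<Rightarrow> 'a graph \<Rightarrow> bool" where
  "subgraph H G \<longleftrightarrow> simple_graph H \<and> verts H \<subseteq> verts G \<and> edges H \<subseteq> edges G"

definition graph_iso :: "'a graph \<Rightarrow> 'b graph \<Rightarrow> bool" where
  "graph_iso G H \<longleftrightarrow>
     (\<exists>f. bij_betw f (verts G) (verts H) \<and> edges H = (\<lambda>e. f ` e) ` edges G)"

definition contains_copy :: "'a graph \<Rightarrow> 'b graph \<Rightarrow> bool" where
  "contains_copy G H \<longleftrightarrow> (\<exists>S. subgraph S G \<and> graph_iso H S)"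

definition two_coloring :: "'a graph \<Rightarrow> 'a graph \<Rightarrow> 'a graph \<Rightarrow> bool" where
  "two_coloring G R B \<longleftrightarrow>
     simple_graph R \<and> simple_graph B \<and> verts R = verts G \<and> verts B = verts G \<and>
     edges G = edges R \<union> edges B \<and> edges R \<inter> edges B = {}"

definition delete_vertex :: "'a graph \<Rightarrow> 'a \<Rightarrow> 'a graph" where
  "delete_vertex G u = (verts G - {u}, {e \<in> edges G. u \<notin> e})"

text \<open>The unordered edges \<open>A \<times> B\<close>, meant for disjoint \<open>A\<close> and \<open>B\<close>.\<close>

definition edges_between :: "'a set \<Rightarrow> 'a set \<Rightarrow> 'a set set" where
  "edges_between A B = {{a, b} | a b. a \<in> A \<and> b \<in> B}"

definition up_to_color :: "('a graph \<Rightarrow> 'a graph \<Rightarrow> bool) \<Rightarrow> 'a graph \<Rightarrow> 'a graph \<Rightarrow> bool" where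
  "up_to_color S R B \<longleftrightarrow> S R B \<or> S B R"

end

theory Submission
  imports Defs
begin

text \<open>
  The hypothesis on \<open>\<beta>\<close> says that the complete graph has at least \<open>3 n / 2\<close> vertices. The proof first finds
  some monochromatic cycle with at least \<open>n\<close> vertices and then studies a shortest one among these.

  \<^emph>\<open>Long cycles.\<close> There is a monochromatic cycle of length 4 (\<open>monochromatic_four_cycle\<close>), and one of length
  \<open>m\<close> with \<open>4 \<le> m < n\<close> is never a longest one (\<open>longer_monochromatic_cycle\<close>). If it is red and cannot be lengthened, any two of the vertices outside it have about
  \<open>m / 2\<close> common blue neighbours on it, by the crossing argument known from Dirac's theorem. As more than
  \<open>m / 2\<close> vertices lie outside, distinct common neighbours can be chosen to form a blue cycle that
  alternates between the cycle and its outside and is longer than \<open>m\<close>.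

  \<^emph>\<open>Odd cycles.\<close> If there is a red cycle of odd length \<open>m \<ge> 7\<close> but no monochromatic cycle of length \<open>m - 1\<close>,
  the chords of length 2 are blue and form a blue cycle of length \<open>m\<close>, and so on. The colours of the chords
  of lengths 1, 2, 4 and 8 are thereby forced, and either this is contradictory at once or rerouting along these chords shortens
  a cycle by one vertex (\<open>odd_cycle_step\<close>).

  \<^emph>\<open>Even cycles.\<close> If there is a red cycle of length \<open>2 l \<ge> 6\<close> but no monochromatic cycle of length \<open>2 l - 1\<close>,
  its alternate vertices form two blue cliques of size \<open>l\<close> (\<open>even_cycle_two_blue_cliques\<close>). The blue
  edges between the cliques share a vertex, for two disjoint ones would give a blue cycle of length
  \<open>2 l - 1\<close>. Apart from that vertex the cliques are completely joined in red, so there is a red cycle of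
  length \<open>2 l - 2\<close>.

  Hence if \<open>2 l\<close> is the least length \<open>\<ge> n\<close> of a monochromatic cycle and there is none of length \<open>n\<close>, then
  \<open>n = 2 l - 1\<close>; in particular there is no such colouring for even \<open>n\<close>. For \<open>n = 2 l - 1\<close> the two cliques
  determine the rest of the colouring (\<open>extremal_structure_of_bipartite_core\<close>), since every deviation from the
  pattern, other than at a single vertex \<open>u\<close>, closes a monochromatic cycle of length \<open>n\<close>.
\<close>

section \<open>Cycles as lists\<close>

definition is_cycle :: "('a \<Rightarrow> 'a \<Rightarrow> bool) \<Rightarrow> 'a list \<Rightarrow> bool" where
  "is_cycle E xs \<longleftrightarrow> 3 \<le> length xs \<and> distinct xs \<and> successively E xs \<and> E (last xs) (hd xs)"

definition has_cycle :: "('a \<Rightarrow> 'a \<Rightarrow> bool) \<Rightarrow> nat \<Rightarrow> bool" where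
  "has_cycle E n \<longleftrightarrow> (\<exists>xs. is_cycle E xs \<and> length xs = n)"

lemma has_cycleI: "is_cycle E xs \<Longrightarrow> length xs = n \<Longrightarrow> has_cycle E n"
  by (auto simp: has_cycle_def)

text \<open>Splicing two lists of (almost) equal length lists the vertices of a walk that alternates between
  them, which is how all alternating cycles below are produced. The induction exchanges the two lists
  at every step, hence the length condition that is stable under this exchange.\<close>

lemma successively_splice:
  assumes "length ys \<le> length xs" "length xs \<le> Suc (length ys)"
    and "\<And>i. i < length ys \<Longrightarrow> E (xs ! i) (ys ! i)"
    and "\<And>i. Suc i < length xs \<Longrightarrow> E (ys ! i) (xs ! Suc i)"
  shows "successively E (splice xs ys)"
  using assms
proof (induction xs ys rule: splice.induct)
  case (1 ys)
  then show ?case by simp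
next
  case (2 x xs ys)
  have IH: "successively E (splice ys xs)"
  proof (rule 2(1))
    show "length xs \<le> length ys" "length ys \<le> Suc (length xs)" using 2(2,3) by simp_all
    show "E (ys ! i) (xs ! i)" if "i < length xs" for i using 2(5)[of i] that by simp
    show "E (xs ! i) (ys ! Suc i)" if "Suc i < length ys" for i using 2(4)[of "Suc i"] that by simp
  qed
  show ?case
  proof (cases ys)
    case Nil
    then show ?thesis using 2(2,3) by simp
  next
    case (Cons y ys')
    then show ?thesis using IH 2(4)[of 0] by simp
  qed
qed

lemma last_splice_same: "length xs = length ys \<Longrightarrow> xs \<noteq> [] \<Longrightarrow> last (splice xs ys) = last ys"
  and last_splice_Suc: "length xs = Suc (length ys) \<Longrightarrow> last (splice xs ys) = last xs"
proof -
  have "(length xs = length ys \<longrightarrow> xs \<noteq> [] \<longrightarrow> last (splice xs ys) = last ys) \<and>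
     (length xs = Suc (length ys) \<longrightarrow> last (splice xs ys) = last xs)"
  proof (induction xs ys rule: splice.induct)
    case (2 x xs ys)
    then show ?case by (cases ys; cases xs) auto
  qed simp
  then show "length xs = length ys \<Longrightarrow> xs \<noteq> [] \<Longrightarrow> last (splice xs ys) = last ys"
    "length xs = Suc (length ys) \<Longrightarrow> last (splice xs ys) = last xs" by blast+
qed

lemma distinct_splice:
  "distinct xs \<Longrightarrow> distinct ys \<Longrightarrow> set xs \<inter> set ys = {} \<Longrightarrow> distinct (splice xs ys)"
  using distinct_disjoint_shuffles splice_in_shuffles by blast

lemma hd_splice: "xs \<noteq> [] \<Longrightarrow> hd (splice xs ys) = hd xs"
  by (cases xs) auto

lemma obtain_distinct_list:
  assumes "k \<le> card X"
  obtains zs where "distinct zs" "length zs = k" "set zs \<subseteq> X"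
proof -
  obtain Y where "Y \<subseteq> X" "card Y = k" "finite Y"
    using obtain_subset_with_card_n[OF assms] by metis
  then show thesis using that finite_distinct_list[of Y] distinct_card by metis
qed

lemma complete_bipartite_even_cycle:
  assumes "symp E" "2 \<le> k" "k \<le> card X" "k \<le> card Y" "X \<inter> Y = {}"
    and "\<And>x y. x \<in> X \<Longrightarrow> y \<in> Y \<Longrightarrow> E x y"
  shows "has_cycle E (2 * k)"
proof -
  obtain xs where xs: "distinct xs" "length xs = k" "set xs \<subseteq> X" using obtain_distinct_list assms(3) .
  obtain ys where ys: "distinct ys" "length ys = k" "set ys \<subseteq> Y" using obtain_distinct_list assms(4) .
  have adj: "E x y" "E y x" if "x \<in> set xs" "y \<in> set ys" for x y
    using assms(6) that xs(3) ys(3) sympD[OF assms(1), of x y] by blast+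
  have ne: "xs \<noteq> []" "ys \<noteq> []" using xs ys assms(2) by auto
  show ?thesis
  proof (rule has_cycleI)
    show "is_cycle E (splice xs ys)"
      unfolding is_cycle_def
      using xs ys ne assms(2,5) adj
      by (auto simp: last_splice_same hd_splice intro!: distinct_splice successively_splice)
    show "length (splice xs ys) = 2 * k" using xs ys by simp
  qed
qed

text \<open>A bipartite graph has no odd cycle, and the two lemmas below are the cheapest ways to get one from
  a complete bipartite graph: one edge inside a part, or one further vertex that sees both parts.\<close>

lemma complete_bipartite_odd_cycle:
  assumes "symp E" "1 \<le> k" "Suc k \<le> card X" "k \<le> card Y" "X \<inter> Y = {}"
    and "\<And>x y. x \<in> X \<Longrightarrow> y \<in> Y \<Longrightarrow> E x y"
    and a: "a \<in> X" "a' \<in> X" "a \<noteq> a'" "E a' a"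
  shows "has_cycle E (Suc (2 * k))"
proof -
  have "finite X" using assms(3) card.infinite by fastforce
  then have "k - 1 \<le> card (X - {a,a'})" using a assms(2,3) by (simp add: card_Diff_subset)
  then obtain zs where zs: "distinct zs" "length zs = k - 1" "set zs \<subseteq> X - {a,a'}"
    using obtain_distinct_list by blast
  define xs where "xs = a # zs @ [a']"
  have xs: "distinct xs" "length xs = Suc k" "set xs \<subseteq> X" "hd xs = a" "last xs = a'"
    using zs a assms(2) by (auto simp: xs_def)
  obtain ys where ys: "distinct ys" "length ys = k" "set ys \<subseteq> Y" using obtain_distinct_list assms(4) .
  have adj: "E x y" "E y x" if "x \<in> set xs" "y \<in> set ys" for x y
    using assms(6) that xs(3) ys(3) sympD[OF assms(1), of x y] by blast+
  have ne: "xs \<noteq> []" using xs by auto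
  show ?thesis
  proof (rule has_cycleI)
    show "is_cycle E (splice xs ys)"
      unfolding is_cycle_def
      using xs(1-3) ys ne assms(2,5) adj a xs(4,5)
      by (auto simp: last_splice_Suc hd_splice intro!: distinct_splice successively_splice)
    show "length (splice xs ys) = Suc (2 * k)" using xs ys by simp
  qed
qed

lemma complete_bipartite_odd_cycle_through:
  assumes "symp E" "1 \<le> k" "k \<le> card X" "k \<le> card Y" "X \<inter> Y = {}"
    and "\<And>x y. x \<in> X \<Longrightarrow> y \<in> Y \<Longrightarrow> E x y"
    and w: "w \<notin> X" "w \<notin> Y" "x \<in> X" "y \<in> Y" "E w x" "E w y"
  shows "has_cycle E (Suc (2 * k))"
proof -
  have fin: "finite X" "finite Y" using assms(2,3,4) card.infinite by fastforce+
  have "k - 1 \<le> card (X - {x})" using w fin assms by simp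
  then obtain xs' where xs': "distinct xs'" "length xs' = k - 1" "set xs' \<subseteq> X - {x}"
    using obtain_distinct_list by blast
  have "k - 1 \<le> card (Y - {y})" using w fin assms by simp
  then obtain ys' where ys': "distinct ys'" "length ys' = k - 1" "set ys' \<subseteq> Y - {y}"
    using obtain_distinct_list by blast
  define xs where "xs = x # xs'"
  define ys where "ys = ys' @ [y]"
  have xs: "distinct xs" "length xs = k" "set xs \<subseteq> X" "hd xs = x" "xs \<noteq> []"
    using xs' w assms(2) by (auto simp: xs_def)
  have ys: "distinct ys" "length ys = k" "set ys \<subseteq> Y" "last ys = y" "ys \<noteq> []"
    using ys' w assms(2) by (auto simp: ys_def)
  have adj: "E x y" "E y x" if "x \<in> set xs" "y \<in> set ys" for x y
    using assms(6) that xs(3) ys(3) sympD[OF assms(1), of x y] by blast+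
  have sp: "distinct (splice xs ys)" "successively E (splice xs ys)" "hd (splice xs ys) = x"
    "last (splice xs ys) = y" "splice xs ys \<noteq> []"
    using xs ys assms(5) adj
    by (auto simp: last_splice_same hd_splice intro!: distinct_splice successively_splice)
  have "set (splice xs ys) = set xs \<union> set ys"
    by (rule set_shuffles[OF splice_in_shuffles])
  then have "w \<notin> set (splice xs ys)" using w xs ys by blast
  then have "is_cycle E (w # splice xs ys)"
    unfolding is_cycle_def
    using sp xs ys assms w by (auto simp: successively_Cons dest: sympD)
  then show ?thesis using xs ys by (auto intro: has_cycleI)
qed

lemma clique_cycle:
  assumes "3 \<le> k" "k \<le> card X" "\<And>x y. x \<in> X \<Longrightarrow> y \<in> X \<Longrightarrow> x \<noteq> y \<Longrightarrow> E x y"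
  shows "has_cycle E k"
proof -
  obtain xs where xs: "distinct xs" "length xs = k" "set xs \<subseteq> X" using obtain_distinct_list assms(2) .
  have "successively E xs"
    using xs assms(3) by (auto simp: successively_conv_nth nth_eq_iff_index_eq subset_iff)
  moreover have "last xs \<noteq> hd xs"
  proof -
    have "xs \<noteq> []" using xs assms(1) by auto
    then show ?thesis
      using xs assms(1) by (simp add: last_conv_nth hd_conv_nth nth_eq_iff_index_eq)
  qed
  moreover have "last xs \<in> X" "hd xs \<in> X"
  proof -
    have "xs \<noteq> []" using xs assms(1) by auto
    then have "last xs \<in> set xs" "hd xs \<in> set xs" by simp_all
    then show "last xs \<in> X" "hd xs \<in> X" using xs(3) by blast+
  qed
  ultimately have "is_cycle E xs"
    using xs assms by (simp add: is_cycle_def)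
  then show ?thesis using xs by (auto intro: has_cycleI)
qed

text \<open>Two cliques \<open>K\<close> and \<open>L\<close> joined by two disjoint edges \<open>a c\<close> and \<open>a' c'\<close> contain a cycle of every
  length that the sizes permit: any number of vertices of \<open>K\<close> can be placed between \<open>a\<close> and \<open>a'\<close>, and
  any number of vertices of \<open>L\<close> between \<open>c'\<close> and \<open>c\<close>. The end vertices may lie outside the cliques as
  long as they are joined to all of their clique, so if no vertex is placed between two of them, they
  must be adjacent themselves.\<close>

lemma cycle_through_two_links:
  assumes "symp E"
    and K: "\<And>x y. x \<in> K \<Longrightarrow> y \<in> insert a (insert a' K) \<Longrightarrow> x \<noteq> y \<Longrightarrow> E x y"
    and L: "\<And>x y. x \<in> L \<Longrightarrow> y \<in> insert c (insert c' L) \<Longrightarrow> x \<noteq> y \<Longrightarrow> E x y"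
    and dis: "(K \<union> {a, a'}) \<inter> (L \<union> {c, c'}) = {}" "a \<noteq> a'" "c \<noteq> c'"
    and links: "E a c" "E a' c'"
    and i: "i \<le> card (K - {a, a'})" "i = 0 \<Longrightarrow> E a a'"
    and j: "j \<le> card (L - {c, c'})" "j = 0 \<Longrightarrow> E c' c"
  shows "has_cycle E (i + j + 4)"
proof -
  have path: "\<exists>zs. distinct zs \<and> length zs = i \<and> set zs \<subseteq> K - {a, a'} \<and> successively E (a # zs @ [a'])"
    if K: "\<And>x y. x \<in> K \<Longrightarrow> y \<in> insert a (insert a' K) \<Longrightarrow> x \<noteq> y \<Longrightarrow> E x y"
      and i: "i \<le> card (K - {a, a'})" "i = 0 \<Longrightarrow> E a a'" for K :: "'a set" and a a' i
  proof -
    obtain zs where zs: "distinct zs" "length zs = i" "set zs \<subseteq> K - {a,a'}"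
      using obtain_distinct_list i(1) .
    have 1: "successively E zs"
      using zs K by (auto simp: successively_conv_nth nth_eq_iff_index_eq subset_iff)
    have "successively E (a # zs @ [a'])"
    proof (cases "zs = []")
      case True
      then show ?thesis using i zs by simp
    next
      case False
      then have "hd zs \<in> set zs" "last zs \<in> set zs" by simp_all
      then have "hd zs \<in> K - {a,a'}" "last zs \<in> K - {a,a'}" using zs(3) by blast+
      then have "E a (hd zs)" "E (last zs) a'" using K assms(1) by (auto dest: sympD)
      then show ?thesis using 1 False by (auto simp: successively_Cons successively_append_iff)
    qed
    then show ?thesis using zs by blast
  qed
  obtain zs where zs: "distinct zs" "length zs = i" "set zs \<subseteq> K - {a, a'}" "successively E (a # zs @ [a'])"
    using path[of K a a' i, OF K i] by blast
  have "\<exists>ys. distinct ys \<and> length ys = j \<and> set ys \<subseteq> L - {c', c} \<and> successively E (c' # ys @ [c])"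
    by (rule path) (use L j in \<open>auto simp: insert_commute\<close>)
  then obtain ys where ys: "distinct ys" "length ys = j" "set ys \<subseteq> L - {c', c}" "successively E (c' # ys @ [c])"
    by blast
  have "is_cycle E ((a # zs @ [a']) @ (c' # ys @ [c]))"
    unfolding is_cycle_def
    using zs ys links dis assms(1)
    by (simp add: successively_append_iff[of _ "a # zs @ [a']"] del: append_Cons append_assoc)
       (auto dest: sympD)
  then show ?thesis by (rule has_cycleI) (simp add: zs ys)
qed

text \<open>Systems of distinct representatives. If each set has at least as many elements as there are
  sets, choosing greedily succeeds. If each has at most one element fewer, the greedy choice can only
  fail at the last set, and it does not fail there if one of the elements chosen before lies outside
  the last set. So there are distinct representatives unless all the sets coincide.\<close>

lemma greedy_choice:
  assumes "finite I" "finite F"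
    and "\<And>i. i \<in> I \<Longrightarrow> card I + card F \<le> card (S i)"
  shows "\<exists>g. inj_on g I \<and> (\<forall>i\<in>I. g i \<in> S i - F)"
  using assms
proof (induction I arbitrary: F rule: finite_induct)
  case (insert i I)
  have "card F < card (S i)" using insert.prems(2)[of i] insert.hyps by simp
  then obtain y where y: "y \<in> S i" "y \<notin> F"
    by (metis card_mono insert.prems(1) leD subsetI)
  have "\<exists>g. inj_on g I \<and> (\<forall>i\<in>I. g i \<in> S i - insert y F)"
    by (rule insert.IH) (use insert.prems insert.hyps y in force)+
  then obtain g where g: "inj_on g I" "\<forall>i\<in>I. g i \<in> S i - insert y F" by blast
  have "inj_on (g(i := y)) (insert i I)"
    using g insert.hyps by (auto simp: inj_on_def)
  moreover have "\<forall>j\<in>insert i I. (g(i := y)) j \<in> S j - F" using g y by auto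
  ultimately show ?case by blast
qed auto

lemma almost_greedy_choice:
  assumes "finite I" "p \<in> I" "q \<in> I" "x \<in> S p" "x \<notin> S q"
    and "\<And>i. i \<in> I \<Longrightarrow> card I \<le> Suc (card (S i))"
  shows "\<exists>g. inj_on g I \<and> (\<forall>i\<in>I. g i \<in> S i)"
proof -
  have pq: "p \<noteq> q" using assms by auto
  have c2: "card (I - {p, q}) + 2 = card I"
    using assms(1-3) pq card_mono[of I "{p,q}"] by (simp add: card_Diff_subset)
  have "\<exists>g. inj_on g (I - {p,q}) \<and> (\<forall>i\<in>I - {p,q}. g i \<in> S i - {x})"
    by (rule greedy_choice) (use assms(1,6) c2 in force)+
  then obtain g where g: "inj_on g (I - {p,q})" "\<forall>i\<in>I - {p,q}. g i \<in> S i - {x}" by blast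
  have "card (g ` (I - {p,q})) < card (S q)"
    using card_image_le[of "I - {p,q}" g] c2 assms(6)[OF assms(3)] assms(1) by simp
  then obtain y where y: "y \<in> S q" "y \<notin> g ` (I - {p,q})"
    by (metis card_mono assms(1) finite_Diff finite_imageI leD subsetI)
  have xy: "x \<noteq> y" using y assms by auto
  have "inj_on (g(p := x, q := y)) I"
    unfolding inj_on_def
  proof (intro ballI impI)
    fix i j assume "i \<in> I" "j \<in> I" and eq: "(g(p := x, q := y)) i = (g(p := x, q := y)) j"
    then show "i = j"
      using g y xy pq inj_onD[OF g(1), of i j]
      by (cases "i = p"; cases "i = q"; cases "j = p"; cases "j = q") force+
  qed
  moreover have "\<forall>i\<in>I. (g(p := x, q := y)) i \<in> S i" using g y assms by auto
  ultimately show ?thesis by blast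
qed

section \<open>Cycles as periodic sequences\<close>

text \<open>A cycle of length \<open>m\<close> is also read as a sequence over the integers with period \<open>m\<close>. Arcs and
  chords are then given by integer indices, without case distinctions for passing the starting point.\<close>

definition winding :: "('a \<Rightarrow> 'a \<Rightarrow> bool) \<Rightarrow> nat \<Rightarrow> (int \<Rightarrow> 'a) \<Rightarrow> bool" where
  "winding E m f \<longleftrightarrow> 3 \<le> m \<and> (\<forall>i j. f i = f j \<longleftrightarrow> i mod int m = j mod int m) \<and> (\<forall>i. E (f i) (f (i + 1)))"

lemma winding_edge: "winding E m f \<Longrightarrow> E (f i) (f (i + 1))"
  by (simp add: winding_def)

lemma winding_edge': "winding E m f \<Longrightarrow> j = i + 1 \<Longrightarrow> E (f i) (f j)"
  by (simp add: winding_def)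

lemma winding_cong: "winding E m f \<Longrightarrow> i mod int m = j mod int m \<Longrightarrow> f i = f j"
  by (simp add: winding_def)

lemma winding_period: "winding E m f \<Longrightarrow> f (i + int m) = f i"
  by (simp add: winding_def)

lemma has_cycle_winding:
  assumes "has_cycle E m" obtains f where "winding E m f"
proof -
  obtain xs where xs: "distinct xs" "length xs = m" "3 \<le> m" "successively E xs" "E (last xs) (hd xs)"
    using assms by (auto simp: has_cycle_def is_cycle_def)
  define f where "f i = xs ! nat (i mod int m)" for i
  have "f i = f j \<longleftrightarrow> i mod int m = j mod int m" for i j
  proof -
    have "0 \<le> i mod int m" "i mod int m < int m" "0 \<le> j mod int m" "j mod int m < int m"
      using xs(3) by simp_all
    then show ?thesis unfolding f_def using xs(1,2)
      by (metis eq_nat_nat_iff nat_less_iff nth_eq_iff_index_eq)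
  qed
  moreover have "E (f i) (f (i + 1))" for i
  proof -
    define k where "k = nat (i mod int m)"
    have k: "k < m" "int k = i mod int m" using xs(3) by (auto simp: k_def nat_less_iff)
    have eq: "(i + 1) mod int m = (int k + 1) mod int m" using k by (simp add: mod_simps)
    show ?thesis
    proof (cases "Suc k < m")
      case True
      then have "f (i + 1) = xs ! Suc k" using eq by (simp add: f_def nat_add_distrib)
      moreover have "f i = xs ! k" by (simp add: f_def k_def)
      ultimately show ?thesis using xs True by (auto simp: successively_conv_nth)
    next
      case False
      then have "int k + 1 = int m" using k by linarith
      then have "f (i + 1) = xs ! 0" using eq by (simp add: f_def)
      moreover have "k = m - 1" using False k by linarith
      then have "f i = xs ! (m - 1)" by (simp add: f_def k_def)
      moreover have "xs \<noteq> []" using xs by auto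
      ultimately show ?thesis using xs(2,5) by (simp add: last_conv_nth hd_conv_nth)
    qed
  qed
  ultimately show thesis using that xs(3) by (auto simp: winding_def)
qed

lemma inj_on_window:
  assumes "winding E m f" shows "inj_on f {s..<s + int m}"
proof (rule inj_onI)
  fix i j assume ij: "i \<in> {s..<s + int m}" "j \<in> {s..<s + int m}" "f i = f j"
  then have "i mod int m = j mod int m" using assms by (simp add: winding_def)
  then have "int m dvd i - j" by (simp add: mod_eq_dvd_iff)
  moreover have "\<bar>i - j\<bar> < int m" using ij by auto
  ultimately show "i = j" using dvd_imp_le_int[of "i - j" "int m"] by linarith
qed

lemma distinct_window:
  assumes "winding E m f" "distinct js" "set js \<subseteq> {s..<s + int m}"
  shows "distinct (map f js)"
proof -
  have "inj_on f (set js)" by (rule inj_on_subset[OF inj_on_window[OF assms(1)] assms(3)])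
  then show ?thesis using assms(2) by (simp add: distinct_map)
qed

lemma successively_upto:
  assumes "\<And>k. i \<le> k \<Longrightarrow> k < j \<Longrightarrow> P k (k + 1)"
  shows "successively P [i..j]"
  unfolding successively_conv_nth
proof (intro allI impI)
  fix k assume "Suc k < length [i..j]"
  then have "int k + 1 \<le> j - i" by simp
  then show "P ([i..j] ! k) ([i..j] ! Suc k)"
    using assms[of "i + int k"] by (simp add: nth_upto ac_simps)
qed

lemma winding_arc: "winding E m f \<Longrightarrow> successively E (map f [i..j])"
  unfolding successively_map by (rule successively_upto) (rule winding_edge)

lemma hd_upto: "i \<le> j \<Longrightarrow> hd [i..j] = i" and last_upto: "i \<le> j \<Longrightarrow> last [i..j] = j"
   by (simp add: upto.simps[of i j]) (simp add: upto_rec2)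

lemma upto_Nil_iff: "[i..j] = [] \<longleftrightarrow> j < (i::int)" by auto

lemma winding_shift:
  assumes "winding E m f" shows "winding E m (\<lambda>i. f (i + s))"
proof -
  have "E (f (i + s)) (f (i + 1 + s))" for i
    by (rule winding_edge'[OF assms]) simp
  then show ?thesis using assms unfolding winding_def by (simp add: mod_eq_dvd_iff)
qed

lemma range_winding: "winding E m f \<Longrightarrow> range f = f ` {0..<int m}"
proof -
  assume w: "winding E m f"
  have "f i \<in> f ` {0..<int m}" for i
  proof -
    have "f i = f (i mod int m)" "i mod int m \<in> {0..<int m}"
      using w by (auto simp: winding_def)
    then show ?thesis by (metis imageI)
  qed
  then show ?thesis by blast
qed

text \<open>All the rerouted cycles below visit vertices of a given cycle in a new order, described by a list
  of indices out of one period.\<close>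

lemma has_cycle_of_indices:
  assumes "winding E m f" "distinct js" "set js \<subseteq> {s..<s + int m}" "length js = k" "3 \<le> k"
    and "successively (\<lambda>i j. E (f i) (f j)) js" "E (f (last js)) (f (hd js))"
  shows "has_cycle E k"
proof (rule has_cycleI)
  have "js \<noteq> []" using assms by auto
  then show "is_cycle E (map f js)"
    unfolding is_cycle_def using assms distinct_window[OF assms(1-3)]
    by (simp add: last_map hd_map successively_map)
qed (simp add: assms)

lemma winding_arc': "winding E m f \<Longrightarrow> successively (\<lambda>i j. E (f i) (f j)) [a..b]"
  by (rule successively_upto) (rule winding_edge)

lemma two_chord_cycle:
  assumes "winding E m f" "4 \<le> m" "E (f i) (f (i + 2))"
  shows "has_cycle E (m - 1)"
proof (rule has_cycle_of_indices[OF assms(1), where s = "i + 1" and js = "[i + 2..i + int m]"])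
  show "E (f (last [i + 2..i + int m])) (f (hd [i + 2..i + int m]))"
    using assms by (simp add: hd_upto last_upto winding_period[OF assms(1)])
qed (use assms winding_arc'[OF assms(1)] in auto)

text \<open>With all chords of length 4 present, one chord of length 3 makes it possible to cover the window
  from \<open>i - 1\<close> to \<open>i + 8\<close> except for \<open>i + 7\<close> by a path between the ends of the window, so the cycle can be
  shortened by exactly one vertex.\<close>

lemma three_chord_cycle:
  assumes w: "winding E m f" and "symp E" "11 \<le> m" and four: "\<And>i. E (f i) (f (i + 4))"
    and "E (f i) (f (i + 3))"
  shows "has_cycle E (m - 1)"
proof (rule has_cycle_of_indices[OF w, where s = "i - 1" and
      js = "[i - 1, i + 3, i, i + 1, i + 2, i + 6, i + 5, i + 4] @ [i + 8..i + int m - 2]"])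
  have e: "E (f j) (f j')" if "j' = j + 1 \<or> j' = j - 1 \<or> j' = j + 4 \<or> j' = j - 3 \<and> j' = i" for j j'
    using that winding_edge[OF w] four assms(2,5) by (auto dest: sympD) (metis diff_add_cancel sympD)
  show "successively (\<lambda>i j. E (f i) (f j))
     ([i - 1, i + 3, i, i + 1, i + 2, i + 6, i + 5, i + 4] @ [i + 8..i + int m - 2])"
    using assms(3) e by (simp add: successively_append_iff successively_Cons hd_upto upto_Nil_iff winding_arc'[OF w])
  have "f (i + int m - 2) = f (i - 2)" using winding_period[OF w, of "i - 2"] by (simp add: algebra_simps)
  then show "E (f (last ([i - 1, i + 3, i, i + 1, i + 2, i + 6, i + 5, i + 4] @ [i + 8..i + int m - 2])))
     (f (hd ([i - 1, i + 3, i, i + 1, i + 2, i + 6, i + 5, i + 4] @ [i + 8..i + int m - 2])))"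
    using assms(3) e by (simp add: last_upto upto_Nil_iff)
qed (use assms(3) in auto)

text \<open>Here the window from \<open>0\<close> to \<open>8\<close> is covered except for \<open>7\<close>.\<close>

lemma six_chord_cycle:
  assumes w: "winding E m f" and "symp E" "9 \<le> m" and four: "\<And>i. E (f i) (f (i + 4))"
    and "E (f 0) (f 6)"
  shows "has_cycle E (m - 1)"
proof (rule has_cycle_of_indices[OF w, where s = 0 and js = "[0, 6, 5, 1, 2, 3, 4] @ [8..int m - 1]"])
  have e: "E (f j) (f j')" if "j' = j + 1 \<or> j' = j - 1 \<or> j' = j + 4 \<or> j' = j - 4" for j j'
    using that winding_edge[OF w] four assms(2) by (auto dest: sympD) (metis diff_add_cancel sympD)+
  show "successively (\<lambda>i j. E (f i) (f j)) ([0, 6, 5, 1, 2, 3, 4] @ [8..int m - 1])"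
    using assms(3,5) e by (simp add: successively_append_iff successively_Cons hd_upto upto_Nil_iff winding_arc'[OF w])
  have "f (int m - 1) = f (- 1)" using winding_period[OF w, of "- 1"] by (simp add: algebra_simps)
  then show "E (f (last ([0, 6, 5, 1, 2, 3, 4] @ [8..int m - 1]))) (f (hd ([0, 6, 5, 1, 2, 3, 4] @ [8..int m - 1])))"
    using assms(3) e by (simp add: last_upto upto_Nil_iff)
qed (use assms(3) in auto)

section \<open>Shortening an odd cycle by one vertex\<close>

text \<open>Both colours are parameters of the locale and enter symmetrically, so every result is also
  available with the colours exchanged.\<close>

locale two_colouring =
  fixes V :: "'a set" and r b :: "'a \<Rightarrow> 'a \<Rightarrow> bool"
  assumes finite_V: "finite V"
    and r_symp: "symp r" and b_symp: "symp b"
    and r_edge: "r x y \<Longrightarrow> x \<in> V \<and> y \<in> V \<and> x \<noteq> y"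
    and b_edge: "b x y \<Longrightarrow> x \<in> V \<and> y \<in> V \<and> x \<noteq> y"
    and b_iff: "x \<in> V \<Longrightarrow> y \<in> V \<Longrightarrow> x \<noteq> y \<Longrightarrow> b x y \<longleftrightarrow> \<not> r x y"
begin

lemma colours_swapped: "two_colouring V b r"
  using two_colouring_axioms unfolding two_colouring_def by metis

lemma r_sym: "r x y \<Longrightarrow> r y x" and b_sym: "b x y \<Longrightarrow> b y x"
  using r_symp b_symp by (auto dest: sympD)

lemma r_or_b: "x \<in> V \<Longrightarrow> y \<in> V \<Longrightarrow> x \<noteq> y \<Longrightarrow> r x y \<or> b x y"
  using b_iff by blast

lemma not_r_b: "r x y \<Longrightarrow> b x y \<Longrightarrow> False"
  using b_iff r_edge by blast

lemma winding_V: "winding r m f \<Longrightarrow> f i \<in> V"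
  using winding_edge r_edge by metis

lemma winding_neq: "winding E m f \<Longrightarrow> 0 < k \<Longrightarrow> k < int m \<Longrightarrow> f i \<noteq> f (i + k)"
  using inj_onD[OF inj_on_window[of E m f i], of i "i + k"] by auto

lemma two_chord_blue:
  assumes "winding r m f" "4 \<le> m" "\<not> has_cycle r (m - 1)"
  shows "b (f i) (f (i + 2))"
proof -
  have "f i \<noteq> f (i + 2)" using winding_neq[OF assms(1)] assms(2) by simp
  then show ?thesis using two_chord_cycle[OF assms(1,2), of i] assms(3)
      r_or_b winding_V[OF assms(1)] by blast
qed

text \<open>As the chords of length 2 are blue, walking along them in an odd cycle visits every vertex and
  gives a blue cycle of the same length.\<close>

lemma double_winding:
  assumes "winding r m f" "odd m" "4 \<le> m" "\<not> has_cycle r (m - 1)"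
  shows "winding b m (\<lambda>i. f (2 * i))"
  unfolding winding_def
proof (intro conjI allI)
  fix i j
  have "coprime (int m) 2" using assms(2) by simp
  then have "2 * i mod int m = 2 * j mod int m \<longleftrightarrow> i mod int m = j mod int m"
    by (metis coprime_dvd_mult_right_iff mod_eq_dvd_iff right_diff_distrib)
  then show "f (2 * i) = f (2 * j) \<longleftrightarrow> i mod int m = j mod int m"
    using assms(1) by (simp add: winding_def)
  show "b (f (2 * i)) (f (2 * (i + 1)))"
    using two_chord_blue[OF assms(1,3,4), of "2 * i"] by (simp add: algebra_simps)
qed (use assms in simp)

text \<open>If neither colour had a cycle of length \<open>m - 1\<close>, doubling repeatedly would make all chords of
  length 2, 4 and 8 blue, red and blue. For \<open>m = 7\<close> and \<open>m = 9\<close> a chord of length 8 is an edge of the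
  red cycle. For larger \<open>m\<close> consider the blue
  cycle of chords of length 2. Its own chords of length 4 have length 8 in the red cycle and are blue, so its chords of
  length 3, which have length 6 in the red cycle, must be red. But red chords of lengths 4 and 6 shorten the
  red cycle by one vertex.\<close>

lemma odd_cycle_step:
  assumes hc: "has_cycle r m" and m: "odd m" "7 \<le> m"
  shows "has_cycle r (m - 1) \<or> has_cycle b (m - 1)"
proof (rule ccontr)
  assume "\<not> ?thesis"
  then have no: "\<not> has_cycle r (m - 1)" "\<not> has_cycle b (m - 1)" by auto
  interpret s: two_colouring V b r by (rule colours_swapped)
  obtain f where f: "winding r m f" using hc by (rule has_cycle_winding)
  have m4: "4 \<le> m" using m by simp
  have f2: "winding b m (\<lambda>i. f (2 * i))" using double_winding[OF f m(1) m4 no(1)] .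
  have "winding r m (\<lambda>i. f (2 * (2 * i)))" using s.double_winding[OF f2 m(1) m4 no(2)] .
  then have f4: "winding r m (\<lambda>i. f (4 * i))" by simp
  have "winding b m (\<lambda>i. f (4 * (2 * i)))" using double_winding[OF f4 m(1) m4 no(1)] .
  then have f8: "winding b m (\<lambda>i. f (8 * i))" by simp
  have quad: "\<exists>i. j mod int m = 4 * i mod int m" for j
  proof -
    obtain k where k: "int m = 2 * k + 1" using m(1) by (metis even_of_nat oddE)
    \<comment> \<open>With \<open>m = 2 k + 1\<close>, the number \<open>k + 1\<close> is the inverse of 2 modulo \<open>m\<close>.\<close>
    have "j - 4 * ((k + 1) * (k + 1) * j) = int m * (- (int m + 2) * j)"
      by (simp add: k algebra_simps)
    then show ?thesis by (metis dvd_triv_left mod_eq_dvd_iff)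
  qed
  have "m = 7 \<or> m = 9 \<or> 11 \<le> m" using m by presburger
  then consider "m = 7" | "m = 9" | "11 \<le> m" by blast
  then show False
  proof cases
    case 1
    have "f 8 = f 1" using 1 by (intro winding_cong[OF f]) simp
    then show False using winding_edge[OF f8, of 0] winding_edge[OF f, of 0] not_r_b by simp
  next
    case 2
    have "f 8 = f (-1)" using 2 by (intro winding_cong[OF f]) simp
    then show False using winding_edge[OF f8, of 0] winding_edge[OF f, of "-1"] not_r_b[of "f (-1)" "f 0"] b_sym[of "f 0" "f (-1)"] by simp
  next
    case 3
    have chord4: "r (f j) (f (j + 4))" for j
    proof -
      obtain i where i: "j mod int m = 4 * i mod int m" using quad by blast
      then have "(j + 4) mod int m = (4 * i + 4) mod int m" by (rule mod_add_cong) simp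
      then have "f j = f (4 * i)" "f (j + 4) = f (4 * (i + 1))"
        using i by (auto intro!: winding_cong[OF f] simp: algebra_simps)
      then show ?thesis using winding_edge[OF f4, of i] by simp
    qed
    have chord8: "b (f (2 * j)) (f (2 * (j + 4)))" for j
    proof -
      obtain i where i: "j mod int m = 4 * i mod int m" using quad by blast
      have d: "2 * j mod int m = 2 * (4 * i) mod int m" by (rule mod_mult_cong[OF refl i])
      then have "(2 * j + 8) mod int m = (2 * (4 * i) + 8) mod int m" by (rule mod_add_cong) simp
      then have "f (2 * j) = f (8 * i)" "f (2 * (j + 4)) = f (8 * (i + 1))"
        using d by (auto intro!: winding_cong[OF f] simp: algebra_simps)
      then show ?thesis using winding_edge[OF f8, of i] by simp
    qed
    have "\<not> b (f (2 * 0)) (f (2 * (0 + 3)))"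
      using three_chord_cycle[OF f2 b_symp 3 chord8, of 0] no by blast
    moreover have "f 0 \<noteq> f (0 + 6)" by (rule winding_neq[OF f]) (use 3 in auto)
    ultimately have "r (f 0) (f 6)" using r_or_b[OF winding_V[OF f] winding_V[OF f], of 0 6] by simp
    then show False using six_chord_cycle[OF f r_symp _ chord4] 3 no by simp
  qed
qed

end

section \<open>An even cycle that cannot be shortened by one vertex\<close>

lemma pairwise_meeting_edges_star:
  assumes "\<And>a c a' c'. P a c \<Longrightarrow> P a' c' \<Longrightarrow> a = a' \<or> c = c'"
  shows "(\<exists>a. \<forall>x y. P x y \<longrightarrow> x = a) \<or> (\<exists>c. \<forall>x y. P x y \<longrightarrow> y = c)"
  using assms by metis

context two_colouring
begin

text \<open>A red chord \<open>0, 2 j\<close> together with a red chord \<open>1, 2 j + 2\<close> or \<open>- 1, 2 j - 2\<close> shortens the red cycle by one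
  vertex, so the last two chords are blue. They then link the blue path through all odd indices, from
  \<open>1\<close> to \<open>- 1\<close>, with the blue path through all even indices but \<open>2 j\<close>, which runs from \<open>2 j - 2\<close> to
  \<open>2 j + 2\<close>. The result is a blue cycle missing only one vertex.\<close>

lemma even_cycle_same_parity_blue:
  assumes f: "winding r (2 * l) f" and l: "3 \<le> l"
    and no: "\<not> has_cycle r (2 * l - 1)" "\<not> has_cycle b (2 * l - 1)"
    and j: "1 \<le> j" "j \<le> int l - 1"
  shows "b (f i) (f (i + 2 * j))"
proof (rule ccontr)
  assume nb: "\<not> b (f i) (f (i + 2 * j))"
  define g where "g k = f (k + i)" for k
  have g: "winding r (2 * l) g" unfolding g_def by (rule winding_shift[OF f])
  have V: "g k \<in> V" for k by (rule winding_V[OF g])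
  have two: "b (g k) (g (k + 2))" for k
    by (rule two_chord_blue[OF g]) (use l no in auto)
  have period: "g (k + 2 * int l) = g k" for k using winding_period[OF g, of k] by simp
  have "j \<noteq> int l - 1"
  proof
    assume "j = int l - 1"
    then have "g (2 * j + 2) = g 0" using period[of 0] by simp
    then show False using two[of "2 * j"] nb b_sym by (auto simp: g_def algebra_simps)
  qed
  then have j': "j \<le> int l - 2" using j by simp
  have "f i \<noteq> f (i + 2 * j)" by (rule winding_neq[OF f]) (use j in auto)
  then have red: "r (g 0) (g (2 * j))"
    using nb r_or_b[OF V V, of 0 "2 * j"] by (simp add: g_def algebra_simps)
  have parity: "g p \<noteq> g q" if "odd (p - q)" for p q
  proof
    assume "g p = g q"
    then have "2 * int l dvd p - q" using g by (simp add: winding_def mod_eq_dvd_iff)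
    then show False using that by (metis dvd_mult_left)
  qed
  have "\<not> r (g 1) (g (2 * j + 2))"
  proof
    assume chord: "r (g 1) (g (2 * j + 2))"
    have "has_cycle r (2 * l - 1)"
    proof (rule has_cycle_of_indices[OF g, where s = 1 and js = "[1..2 * j] @ rev [2 * j + 2..2 * int l]"])
      show "successively (\<lambda>i j. r (g i) (g j)) ([1..2 * j] @ rev [2 * j + 2..2 * int l])"
        using winding_arc'[OF g] j j' red r_sym period[of 0]
        by (auto simp: successively_append_iff hd_rev last_upto intro!: successively_upto winding_edge[OF g])
      show "r (g (last ([1..2 * j] @ rev [2 * j + 2..2 * int l])))
         (g (hd ([1..2 * j] @ rev [2 * j + 2..2 * int l])))"
        using j j' chord r_sym by (simp add: last_rev hd_upto hd_append)
    qed (use j j' l in auto)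
    then show False using no by simp
  qed
  then have b1: "b (g 1) (g (2 * j + 2))" 
    using r_or_b[OF V V, of 1 "2 * j + 2"] parity[of 1 "2 * j + 2"] by simp
  have "\<not> r (g (- 1)) (g (2 * j - 2))"
  proof
    assume chord: "r (g (- 1)) (g (2 * j - 2))"
    have "g (2 * int l - 1) = g (- 1)" using period[of "-1"] by (simp add: algebra_simps)
    have "has_cycle r (2 * l - 1)"
    proof (rule has_cycle_of_indices[OF g, where s = 0 and js = "[2 * j..2 * int l - 1] @ rev [0..2 * j - 2]"])
      show "successively (\<lambda>i j. r (g i) (g j)) ([2 * j..2 * int l - 1] @ rev [0..2 * j - 2])"
        using winding_arc'[OF g] j j' chord r_sym \<open>g (2 * int l - 1) = g (- 1)\<close>
        by (auto simp: successively_append_iff hd_rev last_upto intro!: successively_upto winding_edge[OF g])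
      show "r (g (last ([2 * j..2 * int l - 1] @ rev [0..2 * j - 2])))
         (g (hd ([2 * j..2 * int l - 1] @ rev [0..2 * j - 2])))"
        using j j' red r_sym by (simp add: last_rev hd_upto hd_append)
    qed (use j j' l in auto)
    then show False using no by simp
  qed
  then have b2: "b (g (2 * int l - 1)) (g (2 * j - 2))"
    using r_or_b[OF V V, of "-1" "2 * j - 2"] parity[of "-1" "2 * j - 2"] period[of "-1"]
    by (simp add: algebra_simps)
  have b3: "b (g 0) (g (2 * int l - 2))"
    using two[of "-2"] period[of "-2"] b_sym by (simp add: algebra_simps)
  \<comment> \<open>The even indices descend from \<open>2 j - 2\<close> to \<open>0\<close>, pass to \<open>2 l - 2\<close>, and descend to \<open>2 j + 2\<close>, so that
    all indices stay in one period.\<close>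
  define odds where "odds = map (\<lambda>k. 2 * k + 1) [0..int l - 1]"
  define ev1 where "ev1 = map (\<lambda>k. 2 * k) (rev [0..j - 1])"
  define ev2 where "ev2 = map (\<lambda>k. 2 * k) (rev [j + 1..int l - 1])"
  have ne: "odds \<noteq> []" "ev1 \<noteq> []" "ev2 \<noteq> []" using j j' l by (auto simp: odds_def ev1_def ev2_def)
  have ends: "hd odds = 1" "last odds = 2 * int l - 1" "hd ev1 = 2 * j - 2" "last ev1 = 0"
    "hd ev2 = 2 * int l - 2" "last ev2 = 2 * j + 2"
    using j j' l by (simp_all add: odds_def ev1_def ev2_def hd_map last_map hd_rev last_rev hd_upto last_upto)
  have two': "b (g (2 * k)) (g (2 * (k + 1)))" "b (g (2 * (k + 1))) (g (2 * k))"
     "b (g (2 * k + 1)) (g (2 * (k + 1) + 1))" for k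
    using two[of "2 * k"] two[of "2 * k + 1"] b_sym by (auto simp: algebra_simps)
  have "has_cycle b (2 * l - 1)"
  proof (rule has_cycleI)
    have "distinct (map g (odds @ ev1 @ ev2))"
    proof (rule distinct_window[OF g, where s = 0])
      show "distinct (odds @ ev1 @ ev2)"
        by (auto simp: odds_def ev1_def ev2_def distinct_map inj_on_def; presburger)
      show "set (odds @ ev1 @ ev2) \<subseteq> {0..<0 + int (2 * l)}"
        using j j' by (auto simp: odds_def ev1_def ev2_def)
    qed
    moreover have "successively b (map g odds)" "successively b (map g ev1)" "successively b (map g ev2)"
      unfolding odds_def ev1_def ev2_def map_map successively_map successively_rev o_def
      by (rule successively_upto, rule two')+
    then have "successively b (map g (odds @ ev1 @ ev2))"
      using ne ends b2 b3 by (simp add: successively_append_iff last_map hd_map hd_append)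
    ultimately show "is_cycle b (map g (odds @ ev1 @ ev2))"
      unfolding is_cycle_def using ne ends b1 b_sym l
      by (simp add: last_map hd_map hd_append) (simp add: odds_def)
    show "length (map g (odds @ ev1 @ ev2)) = 2 * l - 1"
      using j j' by (simp add: odds_def ev1_def ev2_def)
  qed
  then show False using no by simp
qed

definition clique :: "('a \<Rightarrow> 'a \<Rightarrow> bool) \<Rightarrow> 'a set \<Rightarrow> bool" where
  "clique E X \<longleftrightarrow> X \<subseteq> V \<and> (\<forall>x\<in>X. \<forall>y\<in>X. x \<noteq> y \<longrightarrow> E x y)"

lemma cliqueD: "clique E X \<Longrightarrow> x \<in> X \<Longrightarrow> y \<in> X \<Longrightarrow> x \<noteq> y \<Longrightarrow> E x y"
  by (simp add: clique_def)

lemma even_cycle_two_blue_cliques: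
  assumes "has_cycle r (2 * l)" and l: "3 \<le> l"
    and no: "\<not> has_cycle r (2 * l - 1)" "\<not> has_cycle b (2 * l - 1)"
  obtains X Y where "clique b X" "clique b Y" "X \<inter> Y = {}" "card X = l" "card Y = l"
proof -
  obtain f where f: "winding r (2 * l) f" using assms(1) by (rule has_cycle_winding)
  have inj: "p = q" if "f p = f q" "p \<in> {0..<2 * int l}" "q \<in> {0..<2 * int l}" for p q
    using inj_onD[OF inj_on_window[OF f, of 0], of p q] that by simp
  have cl: "clique b ((\<lambda>i. f (2 * i + s)) ` {0..<int l})" for s
  proof -
    have "b (f (2 * i + s)) (f (2 * j + s))" if "0 \<le> i" "i < j" "j < int l" for i j
      using even_cycle_same_parity_blue[OF f l no, of "j - i" "2 * i + s"] that
      by (simp add: algebra_simps)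
    then have "b (f (2 * i + s)) (f (2 * j + s))" if "i \<in> {0..<int l}" "j \<in> {0..<int l}" "i \<noteq> j" for i j
      using that b_sym by (cases "i < j") auto
    then show ?thesis unfolding clique_def using winding_V[OF f] by (auto simp: image_def) metis
  qed
  show thesis
  proof (rule that[OF cl[of 0] cl[of 1]])
    show "(\<lambda>i. f (2 * i + 0)) ` {0..<int l} \<inter> (\<lambda>i. f (2 * i + 1)) ` {0..<int l} = {}"
    proof -
      have "f (2 * p) \<noteq> f (2 * q + 1)" if "p \<in> {0..<int l}" "q \<in> {0..<int l}" for p q
        using inj[of "2 * p" "2 * q + 1"] that by auto presburger
      then show ?thesis by auto
    qed
    have "inj_on (\<lambda>i. f (2 * i + s)) {0..<int l}" if "s = 0 \<or> s = 1" for s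
      using inj that by (auto simp: inj_on_def) force+
    from this[of 0] this[of 1]
    show "card ((\<lambda>i. f (2 * i + 0)) ` {0..<int l}) = l" "card ((\<lambda>i. f (2 * i + 1)) ` {0..<int l}) = l"
      by (simp_all add: card_image)
  qed
qed

text \<open>Two disjoint blue edges between the cliques would close a blue cycle of length \<open>2 l - 1\<close>, so all
  blue edges between them share a vertex, and that vertex is given up.\<close>

lemma red_between_blue_cliques:
  assumes X: "clique b X" "card X = l" and Y: "clique b Y" "card Y = l"
    and dis: "X \<inter> Y = {}" and l: "3 \<le> l" and no: "\<not> has_cycle b (2 * l - 1)"
  obtains X' Y' where "clique b X'" "clique b Y'" "X' \<inter> Y' = {}" "card X' = l - 1" "card Y' = l"
    "\<And>x y. x \<in> X' \<Longrightarrow> y \<in> Y' \<Longrightarrow> r x y"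
proof -
  have fin: "finite X" "finite Y" using X Y l card.infinite by fastforce+
  have star: "a = a' \<or> c = c'"
    if "a \<in> X \<and> c \<in> Y \<and> b a c" "a' \<in> X \<and> c' \<in> Y \<and> b a' c'" for a c a' c'
  proof (rule ccontr)
    assume ne: "\<not> (a = a' \<or> c = c')"
    \<comment> \<open>The cycle takes \<open>l - 1\<close> vertices from \<open>X\<close> and all \<open>l\<close> from \<open>Y\<close>.\<close>
    have "card (X - {a, a'}) = l - 2" "card (Y - {c, c'}) = l - 2"
      using that ne X Y by (simp_all add: card_Diff_subset)
    then have "has_cycle b ((l - 3) + (l - 2) + 4)"
      using that ne X Y dis l
      by (intro cycle_through_two_links[OF b_symp, of X a a' Y c c'])
        (auto intro: cliqueD[OF X(1)] cliqueD[OF Y(1)])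
    moreover have "(l - 3) + (l - 2) + 4 = 2 * l - 1" using l by simp
    ultimately show False using no by simp
  qed
  have red: "r x y" if "x \<in> X" "y \<in> Y" "\<not> b x y" for x y
  proof -
    have "x \<in> V" "y \<in> V" "x \<noteq> y" using that X Y dis by (auto simp: clique_def)
    then show ?thesis using r_or_b that(3) by blast
  qed
  have sub: "clique b (Z - {z})" if "clique b Z" for Z z using that by (auto simp: clique_def)
  have "card (Z - {z}) = l - 1" if "z \<in> Z" "card Z = l" "finite Z" for Z and z :: 'a using that by simp
  note del = sub this
  have "(\<exists>a. \<forall>x y. x \<in> X \<and> y \<in> Y \<and> b x y \<longrightarrow> x = a) \<or>
      (\<exists>c. \<forall>x y. x \<in> X \<and> y \<in> Y \<and> b x y \<longrightarrow> y = c)"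
    by (rule pairwise_meeting_edges_star) (rule star)
  then show thesis
  proof (elim disjE exE)
    fix a assume a: "\<forall>x y. x \<in> X \<and> y \<in> Y \<and> b x y \<longrightarrow> x = a"
    have "X \<noteq> {}" using X l by auto
    then obtain a' where a': "a' \<in> X" "a \<in> X \<longrightarrow> a' = a" by blast
    have "r x y" if "x \<in> X - {a'}" "y \<in> Y" for x y using red[of x y] a a' that by blast
    then show thesis
      by (intro that[of "X - {a'}" Y]) (use a' X Y dis del fin in auto)
  next
    fix c assume c: "\<forall>x y. x \<in> X \<and> y \<in> Y \<and> b x y \<longrightarrow> y = c"
    have "Y \<noteq> {}" using Y l by auto
    then obtain c' where c': "c' \<in> Y" "c \<in> Y \<longrightarrow> c' = c" by blast
    have "r y x" if "y \<in> Y - {c'}" "x \<in> X" for x y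
      using red[of x y] c c' that r_sym by blast
    then show thesis
      by (intro that[of "Y - {c'}" X]) (use c' X Y dis del fin in auto)
  qed
qed

text \<open>The structure spreads from the core to the whole graph. A vertex that has red neighbours in both
  \<open>X\<close> and \<open>Y\<close> would close a red odd cycle, so every vertex is joined in blue to all of \<open>X\<close> or to all of
  \<open>Y\<close>. This divides the vertices into \<open>A\<close> and \<open>C\<close>. As before, two disjoint blue edges between \<open>A\<close> and \<open>C\<close>
  would give a blue cycle of length \<open>2 l - 1\<close>, so removing one vertex \<open>u\<close> makes everything between the
  parts red. Finally, a red edge inside a part would close a red odd cycle, provided that the part has at
  least \<open>l\<close> vertices; the number of vertices and the absence of a blue clique of size \<open>2 l - 1\<close> ensure this.\<close>

lemma extremal_structure_of_bipartite_core:
  assumes X: "clique b X" "card X = l - 1" and Y: "clique b Y" "card Y = l"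
    and dis: "X \<inter> Y = {}" and red: "\<And>x y. x \<in> X \<Longrightarrow> y \<in> Y \<Longrightarrow> r x y"
    and l: "3 \<le> l" and big: "3 * l - 1 \<le> card V"
    and no: "\<not> has_cycle r (2 * l - 1)" "\<not> has_cycle b (2 * l - 1)"
  obtains u U1 U2 where "u \<in> V" "V = U1 \<union> U2 \<union> {u}" "U1 \<inter> U2 = {}" "u \<notin> U1" "u \<notin> U2"
    "clique b U1" "clique b U2" "\<And>x y. x \<in> U1 \<Longrightarrow> y \<in> U2 \<Longrightarrow> r x y"
    "card U1 < 2 * l - 1" "card U2 < 2 * l - 1"
proof -
  have n: "2 * l - 1 = Suc (2 * (l - 1))" using l by simp
  have fin: "finite X" "finite Y" using X Y l card.infinite by fastforce+
  have XV: "X \<subseteq> V" and YV: "Y \<subseteq> V" using X Y by (auto simp: clique_def)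
  define C where "C = Y \<union> {w \<in> V - X - Y. \<forall>y\<in>Y. b w y}"
  define A where "A = V - C"
  have XA: "X \<subseteq> A" and YC: "Y \<subseteq> C" and AC: "A \<inter> C = {}" "A \<union> C = V"
    using XV YV dis by (auto simp: A_def C_def)
  \<comment> \<open>Vertices joined in blue to both \<open>X\<close> and \<open>Y\<close> are counted in \<open>C\<close>, which makes this true for all
    vertices of \<open>A\<close> outside the core.\<close>
  have AX_red: "\<exists>y\<in>Y. r a y" if "a \<in> A - X" for a
    using that XV YV r_or_b[of a] by (force simp: A_def C_def)
  have A_blue: "b x a" if xa: "x \<in> X" "a \<in> A" "x \<noteq> a" for a x
  proof (cases "a \<in> X")
    case True
    then show ?thesis using xa cliqueD[OF X(1)] by blast
  next
    case False
    then obtain y where y: "y \<in> Y" "r a y" using AX_red xa by blast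
    show ?thesis
    proof (rule ccontr)
      assume "\<not> b x a"
      then have "r x a" using xa r_or_b[of x a] XV by (auto simp: A_def)
      then have "r a x" by (rule r_sym)
      have "a \<notin> Y" using xa YC AC by blast
      have "has_cycle r (Suc (2 * (l - 1)))"
        by (rule complete_bipartite_odd_cycle_through[OF r_symp _ _ _ dis red False \<open>a \<notin> Y\<close> xa(1) y(1) \<open>r a x\<close> y(2)])
          (use X Y l in auto)
      then show False using no n by simp
    qed
  qed
  have C_blue: "b y c" if "y \<in> Y" "c \<in> C" "y \<noteq> c" for y c
    using that cliqueD[OF Y(1)] b_sym by (auto simp: C_def)
  have linked: "i + j + 4 \<noteq> 2 * l - 1"
    if h: "a \<in> A" "a' \<in> A" "c \<in> C" "c' \<in> C" "a \<noteq> a'" "c \<noteq> c'" "b a c" "b a' c'"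
      and i: "i \<le> card (X - {a, a'})" "i = 0 \<Longrightarrow> b a a'"
      and j: "j \<le> card (Y - {c, c'})" "j = 0 \<Longrightarrow> b c' c" for a a' c c' i j
  proof
    assume eq: "i + j + 4 = 2 * l - 1"
    have "has_cycle b (i + j + 4)"
    proof (rule cycle_through_two_links[OF b_symp, of X a a' Y c c'])
      show "b x y" if "x \<in> X" "y \<in> insert a (insert a' X)" "x \<noteq> y" for x y
        using that A_blue h XA by blast
      show "b x y" if "x \<in> Y" "y \<in> insert c (insert c' Y)" "x \<noteq> y" for x y
        using that C_blue h YC by blast
      show "(X \<union> {a, a'}) \<inter> (Y \<union> {c, c'}) = {}" using h XA YC AC by blast
    qed (use h i j in auto)
    then show False using no eq by simp
  qed
  have meet: "a = a' \<or> c = c'"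
    if P: "a \<in> A \<and> c \<in> C \<and> b a c" "a' \<in> A \<and> c' \<in> C \<and> b a' c'" for a c a' c'
  proof (rule ccontr)
    assume "\<not> (a = a' \<or> c = c')"
    then have h: "a \<in> A" "a' \<in> A" "c \<in> C" "c' \<in> C" "a \<noteq> a'" "c \<noteq> c'" "b a c" "b a' c'"
      using P by auto
    have "card X - card {a, a'} \<le> card (X - {a, a'})" "card Y - card {c, c'} \<le> card (Y - {c, c'})"
      by (rule diff_card_le_card_Diff; simp)+
    then have cd: "l - 3 \<le> card (X - {a, a'})" "l - 2 \<le> card (Y - {c, c'})"
      using h X Y l by simp_all
    show False
    proof (cases "l = 3")
      case False
      then show False using linked[OF h cd(1) _ cd(2)] l by simp
    next
      case True
      \<comment> \<open>For \<open>l = 3\<close> the cycle has length 5 and leaves no room for a vertex between \<open>a\<close> and \<open>a'\<close>, which would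
        have to be adjacent in blue. Otherwise their red neighbours in \<open>Y\<close> decide: if these
        differ they give a red cycle, and if not, two other vertices of \<open>Y\<close> give a blue one.\<close>
      have "\<not> b a a'" if "b a a'" using linked[OF h, of 0 1] cd True that by simp
      then have naa: "\<not> b a a'" by blast
      then have aX: "a \<notin> X" "a' \<notin> X" using A_blue[of a a'] A_blue[of a' a] h b_sym by blast+
      have raa: "r a a'" using naa h r_or_b[of a a'] AC by blast
      have aY: "a \<notin> Y" "a' \<notin> Y" using h YC AC by blast+
      have "X \<noteq> {}" using X True by auto
      then obtain e where e: "e \<in> X" by blast
      have eY: "e \<notin> Y" "e \<noteq> a" "e \<noteq> a'" using e dis aX by auto
      have same: "y = y'" if y: "y \<in> Y" "y' \<in> Y" "r a y" "r a' y'" for y y'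
      proof (rule ccontr)
        assume "y \<noteq> y'"
        then have "is_cycle r [a, y, e, y', a']"
          using y e eY aX aY raa red[OF e] r_sym h by (auto simp: is_cycle_def)
        then have "has_cycle r 5" by (rule has_cycleI) simp
        then show False using no True by simp
      qed
      obtain y where y: "y \<in> Y" "r a y" using AX_red h aX by blast
      obtain y' where y': "y' \<in> Y" "r a' y'" using AX_red h aX by blast
      have yy: "y' = y" using same y y' by blast
      obtain os where os: "distinct os" "length os = 2" "set os \<subseteq> Y - {y}"
        using obtain_distinct_list[of 2 "Y - {y}"] Y y fin True by auto
      then obtain o1 o2 where o: "o1 \<in> Y" "o1 \<noteq> y" "o2 \<in> Y" "o2 \<noteq> y" "o1 \<noteq> o2"
        by (auto simp: numeral_2_eq_2 length_Suc_conv)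
      have "b a o1" using same[of o1 y] o y' yy r_or_b[of a o1] h AC YV aY by blast
      moreover have "b a' o2" using same[of y o2] o y r_or_b[of a' o2] h AC YV aY by blast
      ultimately have "is_cycle b [a, o1, o2, a', e]"
        using o e eY aX aY h cliqueD[OF Y(1) o(1,3,5)] A_blue[OF e h(1)] A_blue[OF e h(2)] b_sym
        by (auto simp: is_cycle_def)
      then have "has_cycle b 5" by (rule has_cycleI) simp
      then show False using no True by simp
    qed
  qed
  have "\<exists>u\<in>V. \<forall>x y. x \<in> A \<and> y \<in> C \<and> b x y \<longrightarrow> x = u \<or> y = u"
  proof (cases "\<exists>x y. x \<in> A \<and> y \<in> C \<and> b x y")
    case True
    have "(\<exists>a. \<forall>x y. x \<in> A \<and> y \<in> C \<and> b x y \<longrightarrow> x = a) \<or>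
        (\<exists>c. \<forall>x y. x \<in> A \<and> y \<in> C \<and> b x y \<longrightarrow> y = c)"
      by (rule pairwise_meeting_edges_star) (rule meet)
    then show ?thesis using True b_edge by metis
  next
    case False
    moreover have "V \<noteq> {}" using big l by auto
    ultimately show ?thesis by blast
  qed
  then obtain u where u: "u \<in> V" "\<And>x y. x \<in> A \<Longrightarrow> y \<in> C \<Longrightarrow> b x y \<Longrightarrow> x = u \<or> y = u" by blast
  define U1 where "U1 = A - {u}"
  define U2 where "U2 = C - {u}"
  have cross: "r x y" if "x \<in> U1" "y \<in> U2" for x y
    using that u(2)[of x y] r_or_b[of x y] AC by (auto simp: U1_def U2_def)
  have finAC: "finite A" "finite C" using finite_V AC by (metis finite_Un)+
  have cAC: "card A + card C = card V" using AC finAC by (metis card_Un_disjoint)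
  have part: "V = U1 \<union> U2 \<union> {u}" "U1 \<inter> U2 = {}" "u \<notin> U1" "u \<notin> U2"
    using AC u by (auto simp: U1_def U2_def)
  have sum: "card U1 + card U2 + 1 = card V"
  proof -
    have "card V = card (insert u (U1 \<union> U2))" using part(1) by simp
    then show ?thesis using part finAC by (simp add: card_Un_disjoint U1_def U2_def)
  qed
  have cC: "l \<le> card C" using card_mono[OF finAC(2) YC] Y by simp
  have cA: "l - 1 \<le> card A" using card_mono[OF finAC(1) XA] X by simp
  have small2: "l - 1 \<le> card U2" using cC finAC by (auto simp: U2_def card_Diff_singleton_if)
  \<comment> \<open>The only doubtful case is \<open>A = X\<close> and \<open>u \<in> X\<close>. Then \<open>C\<close> has at least \<open>2 l\<close> vertices, and alternating
    between \<open>Y\<close> and the rest of \<open>C\<close> gives a blue cycle.\<close>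
  have small1: "l - 1 \<le> card U1"
  proof (cases "l \<le> card A \<or> u \<notin> A")
    case True
    then show ?thesis using cA finAC by (auto simp: U1_def card_Diff_singleton_if)
  next
    case False
    moreover have "card (C - Y) = card C - l" using Y YC fin by (simp add: card_Diff_subset)
    ultimately have "l \<le> card (C - Y)" using cAC big l by linarith
    moreover obtain o1 o2 where o: "o1 \<in> Y" "o2 \<in> Y" "o1 \<noteq> o2"
    proof -
      obtain os where "distinct os" "length os = 2" "set os \<subseteq> Y"
        using obtain_distinct_list[of 2 Y] Y l by auto
      then show thesis using that by (auto simp: numeral_2_eq_2 length_Suc_conv)
    qed
    ultimately have "has_cycle b (Suc (2 * (l - 1)))"
      using Y l C_blue
      by (intro complete_bipartite_odd_cycle[OF b_symp, of "l - 1" Y "C - Y" o1 o2])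
        (auto intro: cliqueD[OF Y(1)])
    then show ?thesis using no n by simp
  qed
  have U_clique: "clique b P"
    if P: "P \<subseteq> V" "Q \<subseteq> V" "P \<inter> Q = {}" "l \<le> card P" "l - 1 \<le> card Q" and PQ: "\<And>x y. x \<in> P \<Longrightarrow> y \<in> Q \<Longrightarrow> r x y" for P Q
    unfolding clique_def
  proof (intro conjI ballI impI)
    fix x y assume xy: "x \<in> P" "y \<in> P" "x \<noteq> y"
    show "b x y"
    proof (rule ccontr)
      assume "\<not> b x y"
      then have "r y x" using xy P r_or_b r_sym by blast
      then have "has_cycle r (Suc (2 * (l - 1)))"
        using complete_bipartite_odd_cycle[OF r_symp _ _ P(5,3) PQ xy] P(4) l by simp
      then show False using no n by simp
    qed
  qed (rule P)
  have le: "card P < 2 * l - 1" if "clique b P" for P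
    using clique_cycle[of "2 * l - 1" P b] cliqueD[OF that] no l by force
  have UV: "U1 \<subseteq> V" "U2 \<subseteq> V" using AC by (auto simp: U1_def U2_def)
  have c1: "clique b U1" if "l \<le> card U1"
    by (rule U_clique[OF UV part(2) that small2 cross])
  have c2: "clique b U2" if "l \<le> card U2"
    by (rule U_clique[OF UV(2,1) _ that small1]) (use part cross r_sym in auto)
  have "l \<le> card U1"
    using le[OF c2] sum big small1 l by linarith
  moreover have "l \<le> card U2"
    using le[OF c1] sum big small2 l by linarith
  ultimately show thesis using that[OF u(1) part _ _ cross] c1 c2 le by blast
qed

end

section \<open>Lengthening a cycle\<close>

lemma alternating_cycle:
  assumes "distinct ws" "length ws = j" "2 \<le> j" "inj_on g {..<j}"
    and "\<And>i. i < j \<Longrightarrow> g i \<notin> set ws \<and> E (ws ! i) (g i) \<and> E (g i) (ws ! (Suc i mod j))"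
  shows "has_cycle E (2 * j)"
proof (rule has_cycleI)
  let ?gs = "map g [0..<j]"
  have ne: "ws \<noteq> []" "?gs \<noteq> []" using assms by auto
  have "E (last ?gs) (hd ws)"
    using assms(5)[of "j - 1"] assms(3) ne by (simp add: last_map hd_conv_nth Suc_diff_Suc)
  moreover have "distinct (splice ws ?gs)"
    using assms by (intro distinct_splice) (auto simp: distinct_map atLeast0LessThan)
  moreover have "successively E (splice ws ?gs)"
  proof (rule successively_splice)
    show "E (?gs ! i) (ws ! Suc i)" if "Suc i < length ws" for i
      using assms(5)[of i] that assms(2) by simp
  qed (use assms in auto)
  ultimately show "is_cycle E (splice ws ?gs)"
    unfolding is_cycle_def using assms(2,3) ne by (simp add: hd_splice last_splice_same)
qed (use assms in simp)

lemma alternating_path_cycle: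
  assumes "distinct ws" "length ws = Suc j" "1 \<le> j" "inj_on g {..<j}"
    and "\<And>i. i < j \<Longrightarrow> g i \<notin> set ws \<and> E (ws ! i) (g i) \<and> E (g i) (ws ! Suc i)"
    and "E (last ws) (hd ws)"
  shows "has_cycle E (Suc (2 * j))"
proof (rule has_cycleI)
  let ?gs = "map g [0..<j]"
  have ne: "ws \<noteq> []" using assms by auto
  have "distinct (splice ws ?gs)"
    using assms by (intro distinct_splice) (auto simp: distinct_map atLeast0LessThan)
  moreover have "successively E (splice ws ?gs)"
    by (rule successively_splice) (use assms in auto)
  ultimately show "is_cycle E (splice ws ?gs)"
    unfolding is_cycle_def using assms(2,3,6) ne by (simp add: hd_splice last_splice_Suc)
qed (use assms in simp)

text \<open>A cyclic order of \<open>t + 1\<close> vertices of \<open>W\<close> becomes an alternating cycle once a common neighbour has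
  been chosen for each of its \<open>t + 1\<close> steps, all distinct. Each step has at least \<open>t\<close> candidates, so by
  the lemma above it suffices that two steps have different candidates: \<open>x\<close> is a candidate for
  the step from \<open>a\<close> to \<open>a'\<close> but not for one that involves \<open>d\<close>.\<close>

lemma cycle_of_uneven_vertex:
  assumes "symp E" "W \<inter> C = {}" "2 \<le> t" "Suc t \<le> card W"
    and common: "\<And>w w'. w \<in> W \<Longrightarrow> w' \<in> W \<Longrightarrow> w \<noteq> w' \<Longrightarrow> t \<le> card {c \<in> C. E w c \<and> E w' c}"
    and x: "x \<in> C" and W: "a \<in> W" "a' \<in> W" "d \<in> W" "a \<noteq> a'" and E: "E a x" "E a' x" "\<not> E d x"
  shows "has_cycle E (2 * Suc t)"
proof -
  have "finite W" using assms(4) card.infinite by fastforce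
  have "d \<noteq> a" "d \<noteq> a'" using E by auto
  then have "card (W - {a, a', d}) = card W - 3"
    using W \<open>finite W\<close> by (simp add: card_Diff_subset)
  then have "t - 2 \<le> card (W - {a, a', d})" using assms(4) by linarith
  then obtain zs where zs: "distinct zs" "length zs = t - 2" "set zs \<subseteq> W - {a, a', d}"
    by (rule obtain_distinct_list)
  define ws where "ws = a # a' # d # zs"
  have ws: "distinct ws" "length ws = Suc t" "set ws \<subseteq> W"
    using zs W \<open>d \<noteq> a\<close> \<open>d \<noteq> a'\<close> assms(3) by (auto simp: ws_def)
  define S where "S i = {c \<in> C. E (ws ! i) c \<and> E (ws ! (Suc i mod Suc t)) c}" for i
  have "card {..<Suc t} \<le> Suc (card (S i))" if "i \<in> {..<Suc t}" for i
  proof -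
    have "i \<noteq> Suc i mod Suc t" using that assms(3) by (cases "i = t") auto
    then have "ws ! i \<noteq> ws ! (Suc i mod Suc t)"
      using that ws by (simp add: nth_eq_iff_index_eq)
    moreover have "ws ! i \<in> W" "ws ! (Suc i mod Suc t) \<in> W"
      using that ws(2) nth_mem[of _ ws] by (auto intro!: subsetD[OF ws(3)])
    ultimately show ?thesis using common unfolding S_def by simp
  qed
  moreover have "x \<in> S 0" "x \<notin> S 1" using x E assms(3) by (auto simp: S_def ws_def)
  ultimately obtain g where g: "inj_on g {..<Suc t}" "\<forall>i\<in>{..<Suc t}. g i \<in> S i"
    using almost_greedy_choice[of "{..<Suc t}" 0 1 x S] assms(3) by auto
  have "has_cycle E (2 * Suc t)"
  proof (rule alternating_cycle[OF ws(1,2) _ g(1)])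
    show "g i \<notin> set ws \<and> E (ws ! i) (g i) \<and> E (g i) (ws ! (Suc i mod Suc t))" if "i < Suc t" for i
      using g(2) that ws(3) assms(2) sympD[OF assms(1)] by (auto simp: S_def)
  qed (use assms(3) in simp)
  then show ?thesis .
qed

text \<open>The same idea for a path of \<open>t + 1\<close> vertices of \<open>W\<close> whose ends are adjacent: here \<open>t\<close> common
  neighbours are inserted. If this fails, all the steps of the path have the same \<open>t - 1\<close> common neighbours.\<close>

lemma common_neighbours_along_path:
  assumes "symp E" "W \<inter> C = {}" "1 \<le> t"
    and common: "\<And>w w'. w \<in> W \<Longrightarrow> w' \<in> W \<Longrightarrow> w \<noteq> w' \<Longrightarrow> t \<le> Suc (card {c \<in> C. E w c \<and> E w' c})"
    and ws: "distinct ws" "length ws = Suc t" "set ws \<subseteq> W" "E (last ws) (hd ws)"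
    and no: "\<not> has_cycle E (Suc (2 * t))"
  shows "x \<in> C \<Longrightarrow> i < t \<Longrightarrow> E (ws ! i) x \<Longrightarrow> E (ws ! Suc i) x \<Longrightarrow> w \<in> set ws \<Longrightarrow> E w x"
    and "card {c \<in> C. E (ws ! 0) c \<and> E (ws ! 1) c} < t"
proof -
  define S where "S i = {c \<in> C. E (ws ! i) c \<and> E (ws ! Suc i) c}" for i
  have card_S: "t \<le> Suc (card (S i))" if "i < t" for i
  proof -
    have "ws ! i \<noteq> ws ! Suc i" using that ws by (simp add: nth_eq_iff_index_eq)
    moreover have "ws ! i \<in> W" "ws ! Suc i \<in> W"
      using that ws(2) nth_mem[of _ ws] by (auto intro!: subsetD[OF ws(3)])
    ultimately show ?thesis using common unfolding S_def by simp
  qed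
  have no_choice: False if "inj_on g {..<t}" "\<forall>i\<in>{..<t}. g i \<in> S i" for g
  proof -
    have "has_cycle E (Suc (2 * t))"
    proof (rule alternating_path_cycle[where E = E and g = g, OF ws(1,2) assms(3) that(1) _ ws(4)])
      show "g i \<notin> set ws \<and> E (ws ! i) (g i) \<and> E (g i) (ws ! Suc i)" if "i < t" for i
        using \<open>\<forall>i\<in>{..<t}. g i \<in> S i\<close> that ws(3) assms(2) sympD[OF assms(1)] by (auto simp: S_def)
    qed
    then show False using no by simp
  qed
  have same: "x \<in> S j" if "x \<in> S i" "i < t" "j < t" for x i j
  proof (rule ccontr)
    assume "x \<notin> S j"
    then have "\<exists>g. inj_on g {..<t} \<and> (\<forall>i\<in>{..<t}. g i \<in> S i)"
      using that card_S by (intro almost_greedy_choice[of "{..<t}" i j x S]) auto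
    then show False using no_choice by blast
  qed
  show "E w x" if h: "x \<in> C" "i < t" "E (ws ! i) x" "E (ws ! Suc i) x" "w \<in> set ws"
  proof -
    have xi: "x \<in> S i" using h by (simp add: S_def)
    obtain j where j: "j \<le> t" "w = ws ! j" using h(5) ws(2) by (auto simp: in_set_conv_nth less_Suc_eq_le)
    show ?thesis
    proof (cases "j < t")
      case True
      then show ?thesis using same[OF xi h(2) True] j by (simp add: S_def)
    next
      case False
      then have "j = Suc (t - 1)" "t - 1 < t" using j assms(3) by auto
      then show ?thesis using same[OF xi h(2), of "t - 1"] j by (simp add: S_def)
    qed
  qed
  show "card {c \<in> C. E (ws ! 0) c \<and> E (ws ! 1) c} < t"
  proof (rule ccontr)
    assume "\<not> ?thesis"
    then have "t \<le> card (S 0)" by (simp add: S_def)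
    moreover have "S i = S 0" if "i < t" for i using same that assms(3) by auto
    ultimately have "t \<le> card (S i)" if "i < t" for i using that by metis
    then have "\<exists>g. inj_on g {..<t} \<and> (\<forall>i\<in>{..<t}. g i \<in> S i - {})"
      by (intro greedy_choice) auto
    then show False using no_choice by auto
  qed
qed

text \<open>Counting consecutive elements of a subset of a cyclic order: a set with few consecutive pairs has
  about half of the elements at most.\<close>

lemma cyclic_shift_card:
  assumes "J \<subseteq> {0..<int m}" "0 < m"
  shows "inj_on (\<lambda>i. (i + 1) mod int m) {0..<int m}"
    and "(\<lambda>i. (i + 1) mod int m) ` J \<subseteq> {0..<int m}"
    and "2 * card J \<le> m + card (J \<inter> (\<lambda>i. (i + 1) mod int m) ` J)"
proof -
  let ?s = "\<lambda>i. (i + 1) mod int m"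
  show inj: "inj_on ?s {0..<int m}"
  proof (rule inj_onI)
    fix i j assume ij: "i \<in> {0..<int m}" "j \<in> {0..<int m}" "?s i = ?s j"
    have "i mod int m = j mod int m" using ij(3) by (simp add: mod_eq_dvd_iff)
    moreover have "i mod int m = i" "j mod int m = j" using ij(1,2) by simp_all
    ultimately show "i = j" by metis
  qed
  show sub: "?s ` J \<subseteq> {0..<int m}" using assms by auto
  have fin: "finite J" using assms finite_subset by blast
  have "card (?s ` J) = card J" by (rule card_image) (rule inj_on_subset[OF inj assms(1)])
  moreover have "card J + card (?s ` J) = card (J \<union> ?s ` J) + card (J \<inter> ?s ` J)"
    using fin by (intro card_Un_Int) auto
  moreover have "card (J \<union> ?s ` J) \<le> m"
    using card_mono[of "{0..<int m}" "J \<union> ?s ` J"] assms(1) sub by simp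
  ultimately show "2 * card J \<le> m + card (J \<inter> ?s ` J)" by simp
qed

context two_colouring
begin

lemma detour_cycle:
  assumes f: "winding r m f" and ps: "distinct ps" "set ps \<inter> range f = {}" "successively r ps" "ps \<noteq> []"
    and d: "1 \<le> d" "d \<le> int m - 2" and e: "r (f i) (hd ps)" "r (last ps) (f (i + d))"
    and k: "int k = int m + 1 - d + int (length ps)"
  shows "has_cycle r k"
proof (rule has_cycleI)
  have "distinct (map f [i + d..i + int m])"
    by (rule distinct_window[OF f, of _ "i + 1"]) (use d in auto)
  then show "is_cycle r (ps @ map f [i + d..i + int m])"
    unfolding is_cycle_def
    using ps e d winding_arc[OF f, of "i + d" "i + int m"] winding_period[OF f, of i]
    by (auto simp: successively_append_iff hd_map last_map hd_upto last_upto)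
  show "length (ps @ map f [i + d..i + int m]) = k" using k d by simp
qed

text \<open>The lists \<open>A\<close> and \<open>B\<close> are the two arcs of a cycle. The vertices \<open>w\<close> and \<open>w'\<close> reconnect them with
  \<open>B\<close> reversed.\<close>

lemma cycle_of_crossing_arcs:
  assumes "symp E" "distinct A" "distinct B" "set A \<inter> set B = {}" "A \<noteq> []" "B \<noteq> []"
    and "successively E A" "successively E B"
    and "w \<notin> set A \<union> set B" "w' \<notin> set A \<union> set B" "w \<noteq> w'"
    and "E (last A) w" "E w (last B)" "E (hd B) w'" "E w' (hd A)"
  shows "is_cycle E (A @ [w] @ rev B @ [w'])"
proof -
  have "successively E (rev B)"
    using assms(1,8) by (auto intro: successively_mono dest: sympD)
  moreover have "3 \<le> length (A @ [w] @ rev B @ [w'])" using assms(5,6) by (cases A; cases B) auto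
  ultimately show ?thesis
    using assms unfolding is_cycle_def
    by (simp add: successively_append_iff successively_Cons hd_rev last_rev hd_append)
qed

lemma crossing_detours_cycle:
  assumes f: "winding r m f" and w: "w \<notin> range f" "w' \<notin> range f" "w \<noteq> w'"
    and ij: "i < j" "j < i + int m"
    and e: "r w (f i)" "r w' (f (i + 1))" "r w (f j)" "r w' (f (j + 1))"
  shows "has_cycle r (m + 2)"
proof (rule has_cycleI)
  let ?A = "[i + 1..j]" and ?B = "[j + 1..i + int m]"
  have "distinct (map f (?A @ ?B))"
    by (rule distinct_window[OF f, of _ "i + 1"]) (use ij in auto)
  then have "distinct (map f ?A)" "distinct (map f ?B)" "set (map f ?A) \<inter> set (map f ?B) = {}"
    by (simp_all only: map_append distinct_append)
  moreover have "set (map f ?A) \<union> set (map f ?B) \<subseteq> range f" by auto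
  moreover have "map f ?A \<noteq> []" "map f ?B \<noteq> []" using ij by auto
  moreover have "hd (map f ?A) = f (i + 1)" "last (map f ?A) = f j"
    "hd (map f ?B) = f (j + 1)" "last (map f ?B) = f i"
    using ij winding_period[OF f, of i] by (simp_all add: hd_map last_map hd_upto last_upto)
  ultimately show "is_cycle r (map f ?A @ [w] @ rev (map f ?B) @ [w'])"
    using w e r_sym winding_arc[OF f] by (intro cycle_of_crossing_arcs[OF r_symp]) auto
  show "length (map f ?A @ [w] @ rev (map f ?B) @ [w']) = m + 2" using ij by simp
qed

text \<open>Here \<open>f\<close> is a red cycle that cannot be made longer. If \<open>w\<close> is joined in red to \<open>f i\<close> and
  \<open>w'\<close> to \<open>f (i + 1)\<close>, this cannot happen for a second index, since crossing detours would lengthen the cycle,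
  and it cannot happen at all if \<open>w w'\<close> is red. So the red neighbours of \<open>w\<close> and \<open>w'\<close> together form a set
  with at most two consecutive pairs, and about half of the cycle is joined in blue to both.\<close>

lemma common_blue_neighbours:
  assumes f: "winding r m f" and m: "4 \<le> m" and no: "\<And>M. m < M \<Longrightarrow> \<not> has_cycle r M"
    and w: "w \<in> V - range f" "w' \<in> V - range f" "w \<noteq> w'"
  shows "m \<le> 2 * card {c \<in> range f. b w c \<and> b w' c} + 2"
    and "r w w' \<Longrightarrow> m \<le> 2 * card {c \<in> range f. b w c \<and> b w' c}"
proof -
  let ?s = "\<lambda>i. (i + 1) mod int m"
  have fs: "f (?s i) = f (i + 1)" for i by (rule winding_cong[OF f]) simp
  define J where "J = {i \<in> {0..<int m}. r w (f i) \<or> r w' (f i)}"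
  have J: "J \<subseteq> {0..<int m}" by (auto simp: J_def)
  have cons: "\<not> (r v (f i) \<and> r v (f (i + 1)))" if "v \<in> V - range f" for v i
    using detour_cycle[OF f, of "[v]" 1 i "m + 1"] that no r_sym m by auto
  have "{c \<in> range f. b w c \<and> b w' c} = f ` ({0..<int m} - J)"
  proof -
    have "b v (f i) \<longleftrightarrow> \<not> r v (f i)" if "v \<in> {w, w'}" for v i
      using that w b_iff[of v "f i"] winding_V[OF f] by auto
    then show ?thesis by (auto simp: J_def range_winding[OF f])
  qed
  moreover have "card (f ` ({0..<int m} - J)) = card ({0..<int m} - J)"
    by (rule card_image, rule inj_on_subset[OF inj_on_window[OF f, of 0]]) auto
  ultimately have card_S: "card {c \<in> range f. b w c \<and> b w' c} + card J = m"
    using J card_mono[OF _ J] finite_subset[OF J] by (simp add: card_Diff_subset)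
  define K where "K v v' = {i \<in> {0..<int m}. r v (f i) \<and> r v' (f (i + 1))}" for v v'
  have sub: "J \<inter> ?s ` J \<subseteq> ?s ` (K w w' \<union> K w' w)"
  proof
    fix k assume k: "k \<in> J \<inter> ?s ` J"
    then obtain i where i: "i \<in> J" "k = ?s i" by blast
    have "r w (f (i + 1)) \<or> r w' (f (i + 1))" using k i fs by (auto simp: J_def)
    then have "i \<in> K w w' \<union> K w' w" using i(1) cons w by (auto simp: J_def K_def)
    then show "k \<in> ?s ` (K w w' \<union> K w' w)" using i(2) by blast
  qed
  have fin: "finite (K v v')" for v v' by (rule finite_subset[of _ "{0..<int m}"]) (auto simp: K_def)
  have K1: "card (K v v') \<le> 1" if v: "v \<in> V - range f" "v' \<in> V - range f" "v \<noteq> v'" for v v'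
  proof -
    have "\<not> i < j" if "i \<in> K v v'" "j \<in> K v v'" for i j
      using crossing_detours_cycle[OF f, of v v' i j] no[of "m + 2"] that v by (auto simp: K_def)
    then have "i = j" if "i \<in> K v v'" "j \<in> K v v'" for i j
      using that by (meson linorder_neqE)
    then show ?thesis using fin[of v v'] by (auto simp: card_le_Suc0_iff_eq)
  qed
  have c: "card (J \<inter> ?s ` J) \<le> card (K w w') + card (K w' w)"
    using card_mono[OF _ sub] card_image_le[of "K w w' \<union> K w' w" ?s] card_Un_le[of "K w w'" "K w' w"] fin
    by (meson finite_UnI finite_imageI le_trans)
  then have "card (J \<inter> ?s ` J) \<le> 2" using K1[OF w] K1[of w' w] w by simp
  then show "m \<le> 2 * card {c \<in> range f. b w c \<and> b w' c} + 2"
    using cyclic_shift_card(3)[OF J] card_S m by simp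
  show "m \<le> 2 * card {c \<in> range f. b w c \<and> b w' c}" if rw: "r w w'"
  proof -
    have "K v v' = {}" if "r v v'" "v \<in> V - range f" "v' \<in> V - range f" "v \<noteq> v'" for v v'
      using detour_cycle[OF f, of "[v, v']" 1 _ "m + 2"] that no r_sym m by (auto simp: K_def)
    then have "card (J \<inter> ?s ` J) = 0" using c w rw r_sym by simp
    then show ?thesis using cyclic_shift_card(3)[OF J] card_S m by simp
  qed
qed

end

lemma obtain_three:
  assumes "3 \<le> card X"
  obtains x y z where "x \<in> X" "y \<in> X" "z \<in> X" "x \<noteq> y" "x \<noteq> z" "y \<noteq> z"
proof -
  obtain zs where "distinct zs" "length zs = 3" "set zs \<subseteq> X"
    using obtain_distinct_list[OF assms] .
  then show thesis using that by (auto simp: numeral_3_eq_3 length_Suc_conv)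
qed

context two_colouring
begin

lemma outside_blue_neighbour:
  assumes "winding r m f" "4 \<le> m" "\<And>M. m < M \<Longrightarrow> \<not> has_cycle r M" "w \<in> V - range f"
  shows "b w (f i) \<or> b w (f (i + 1))"
proof -
  have "\<not> (r w (f i) \<and> r w (f (i + 1)))"
    using detour_cycle[OF assms(1), of "[w]" 1 i "m + 1"] assms r_sym by auto
  moreover have "r w (f k) \<or> b w (f k)" for k
    using r_or_b[of w "f k"] winding_V[OF assms(1), of k] assms(4) by auto
  ultimately show ?thesis by blast
qed

text \<open>The hypothesis says that a vertex of the cycle joined in blue to two vertices of \<open>W\<close> is joined in
  blue to all of \<open>W\<close>. Two consecutive vertices of the cycle cannot both have at most one blue neighbour in
  \<open>W\<close>, because each of three vertices of \<open>W\<close> is joined in blue to one of the two. If \<open>W\<close> is a red clique, a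
  detour through two vertices of \<open>W\<close> excludes distance two as well, which improves the bound from a half
  to two thirds.\<close>

lemma all_blue_cycle_vertices:
  assumes f: "winding r m f" and m: "4 \<le> m" and no: "\<And>M. m < M \<Longrightarrow> \<not> has_cycle r M"
    and W: "W = V - range f" "3 \<le> card W"
    and uniform: "\<And>c a a' d. c \<in> range f \<Longrightarrow> a \<in> W \<Longrightarrow> a' \<in> W \<Longrightarrow> d \<in> W \<Longrightarrow> a \<noteq> a' \<Longrightarrow>
       b a c \<Longrightarrow> b a' c \<Longrightarrow> b d c"
  shows "m \<le> 2 * card {c \<in> range f. \<forall>w\<in>W. b w c}"
    and "(\<And>w w'. w \<in> W \<Longrightarrow> w' \<in> W \<Longrightarrow> w \<noteq> w' \<Longrightarrow> r w w') \<Longrightarrow>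
       2 * m \<le> 3 * card {c \<in> range f. \<forall>w\<in>W. b w c}"
proof -
  let ?s = "\<lambda>i. (i + 1) mod int m"
  have fs: "f (?s i) = f (i + 1)" for i by (rule winding_cong[OF f]) simp
  obtain w1 w2 w3 where w: "w1 \<in> W" "w2 \<in> W" "w3 \<in> W" "w1 \<noteq> w2" "w1 \<noteq> w3" "w2 \<noteq> w3"
    using obtain_three[OF W(2)] .
  define N where "N = {i \<in> {0..<int m}. \<exists>w\<in>W. \<not> b w (f i)}"
  have N: "N \<subseteq> {0..<int m}" by (auto simp: N_def)
  have finN: "finite N" by (rule finite_subset[OF N]) simp
  have one: "\<not> (b w (f i) \<and> b w' (f i))" if "i \<in> N" "w \<in> W" "w' \<in> W" "w \<noteq> w'" for i w w'
    using uniform[of "f i" w w'] that by (auto simp: N_def)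
  have shifted: "\<exists>v\<in>W. \<not> b v (f (i + 1))" if "?s i \<in> N" for i
    using that fs by (auto simp: N_def)
  have "N \<inter> ?s ` N = {}"
  proof (rule ccontr)
    assume "N \<inter> ?s ` N \<noteq> {}"
    then obtain i where i: "i \<in> N" "?s i \<in> N" by blast
    have "b w (f i) \<or> b w (f (i + 1))" if "w \<in> W" for w
      using outside_blue_neighbour[OF f m no] that W by blast
    then show False using w one[OF i(1)] one[OF i(2)] fs[of i] by metis
  qed
  then have "2 * card N \<le> m" using cyclic_shift_card(3)[OF N] m by simp
  moreover have "{c \<in> range f. \<forall>w\<in>W. b w c} = f ` ({0..<int m} - N)"
    by (auto simp: N_def range_winding[OF f])
  then have "card {c \<in> range f. \<forall>w\<in>W. b w c} = card ({0..<int m} - N)"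
    by (simp add: card_image inj_on_subset[OF inj_on_window[OF f, of 0]])
  then have T: "card {c \<in> range f. \<forall>w\<in>W. b w c} + card N = m"
    using card_mono[OF _ N] finN N by (simp add: card_Diff_subset)
  ultimately show "m \<le> 2 * card {c \<in> range f. \<forall>w\<in>W. b w c}" by simp
  assume allred: "\<And>w w'. w \<in> W \<Longrightarrow> w' \<in> W \<Longrightarrow> w \<noteq> w' \<Longrightarrow> r w w'"
  have rb: "r w (f k)" if "w \<in> W" "\<not> b w (f k)" for w k
    using r_or_b[of w "f k"] winding_V[OF f, of k] that W by auto
  have "N \<inter> ?s ` ?s ` N = {}"
  proof (rule ccontr)
    assume "N \<inter> ?s ` ?s ` N \<noteq> {}"
    then obtain i where i: "i \<in> N" "?s (?s i) \<in> N" by blast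
    have fi: "f (?s (?s i)) = f (i + 2)" using fs[of "?s i"] fs[of "i + 1"]
      by (metis (no_types, lifting) winding_cong[OF f] add.assoc mod_add_left_eq one_add_one)
    obtain v where v: "v \<in> W" "\<not> b v (f i)" using i by (auto simp: N_def)
    obtain v' where v': "v' \<in> W" "v' \<noteq> v" "\<not> b v' (f (i + 2))"
    proof -
      obtain x y where "x \<in> W" "y \<in> W" "x \<noteq> v" "y \<noteq> v" "x \<noteq> y" using w by metis
      then show thesis using one[OF i(2), of x y] fi that by metis
    qed
    have "has_cycle r (m + 1)"
      using detour_cycle[OF f, of "[v, v']" 2 i "m + 1"] rb[OF v] rb[OF v'(1,3)] v v' allred[of v v'] r_sym m W
      by auto
    then show False using no by simp
  qed
  \<comment> \<open>Now \<open>N\<close> and its first two shifts are pairwise disjoint.\<close>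
  moreover have "?s ` N \<inter> ?s ` ?s ` N = {}"
    using inj_on_image_Int[OF cyclic_shift_card(1)[of N m] N cyclic_shift_card(2)[OF N]] N m
      \<open>N \<inter> ?s ` N = {}\<close> by auto
  moreover have s1: "?s ` N \<subseteq> {0..<int m}" using cyclic_shift_card(2)[OF N] m by simp
  have s2: "?s ` ?s ` N \<subseteq> {0..<int m}" using cyclic_shift_card(2)[OF s1] m by simp
  have inj: "inj_on ?s {0..<int m}" using cyclic_shift_card(1)[OF N] m by simp
  have c1: "card (?s ` N) = card N" by (rule card_image[OF inj_on_subset[OF inj N]])
  have c2: "card (?s ` ?s ` N) = card N" using card_image[OF inj_on_subset[OF inj s1]] c1 by simp
  ultimately have "card (N \<union> ?s ` N \<union> ?s ` ?s ` N) = card N + card (?s ` N) + card (?s ` ?s ` N)"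
    using \<open>N \<inter> ?s ` N = {}\<close> finN by (subst card_Un_disjoint; auto simp: card_Un_disjoint)
  moreover have "card (N \<union> ?s ` N \<union> ?s ` ?s ` N) \<le> card {0..<int m}"
    by (rule card_mono) (use N s1 s2 in auto)
  ultimately have "3 * card N \<le> m" using c1 c2 by simp
  then show "2 * m \<le> 3 * card {c \<in> range f. \<forall>w\<in>W. b w c}" using T by simp
qed

text \<open>Let \<open>C\<close> be the red cycle and \<open>W\<close> the set of the other vertices, and suppose that there is no longer
  monochromatic cycle. Any two vertices of \<open>W\<close> have about \<open>m / 2\<close> common blue neighbours in \<open>C\<close>, which
  almost suffices for a blue cycle that alternates between \<open>W\<close> and \<open>C\<close> and has more than \<open>m\<close> vertices.

  If \<open>m = 2 k - 1\<close>, a blue cycle through \<open>k\<close> vertices of \<open>W\<close> and \<open>k\<close> of \<open>C\<close> is needed, and \<open>k - 1\<close> common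
  neighbours are guaranteed. So no vertex of \<open>C\<close> distinguishes between vertices of \<open>W\<close> in the sense of
  the lemma \<open>cycle_of_uneven_vertex\<close>, and then at least \<open>k\<close> vertices of \<open>C\<close> are joined in blue to all of \<open>W\<close>.
  The argument is the same if \<open>m = 2 k\<close> and \<open>W\<close> is a red clique, where \<open>k\<close> common neighbours are guaranteed and
  \<open>k + 1\<close> needed. If \<open>m = 2 k\<close> and \<open>W\<close> contains a blue edge, that edge takes the place of one common neighbour
  and closes an odd cycle of length \<open>2 k + 1\<close>.\<close>

lemma longer_monochromatic_cycle:
  assumes hc: "has_cycle r m" and m: "4 \<le> m" and big: "3 * m + 3 \<le> 2 * card V"
  shows "\<exists>M>m. has_cycle r M \<or> has_cycle b M"
proof (rule ccontr)
  assume neg: "\<not> ?thesis"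
  have nor: "\<not> has_cycle r M" and nob: "\<not> has_cycle b M" if "m < M" for M
    using neg that by blast+
  obtain f where f: "winding r m f" using hc by (rule has_cycle_winding)
  define C where "C = range f"
  define W where "W = V - C"
  have cardC: "card C = m"
    unfolding C_def range_winding[OF f] using card_image[OF inj_on_window[OF f, of 0]] by simp
  have CV: "C \<subseteq> V" using winding_V[OF f] by (auto simp: C_def)
  have finC: "finite C" using CV finite_V finite_subset by blast
  have cardW: "card W = card V - m" using CV finC cardC by (simp add: W_def card_Diff_subset)
  have q: "m + 3 \<le> 2 * card W" using big cardW by linarith
  have W3: "3 \<le> card W" using q m by simp
  have dis: "W \<inter> C = {}" by (auto simp: W_def)
  have common: "m \<le> 2 * card {c \<in> C. b w c \<and> b w' c} + 2"
    "r w w' \<Longrightarrow> m \<le> 2 * card {c \<in> C. b w c \<and> b w' c}"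
    if "w \<in> W" "w' \<in> W" "w \<noteq> w'" for w w'
    using common_blue_neighbours[OF f m nor] that by (auto simp: W_def C_def)
  define T where "T = {c \<in> C. \<forall>w\<in>W. b w c}"
  have Wf: "W = V - range f" by (simp add: W_def C_def)
  have T: "W \<inter> T = {}" using dis by (auto simp: T_def)
  have even_or_odd: "(\<exists>k. m = 2 * k) \<or> (\<exists>k. Suc m = 2 * k)" by presburger
  have rb: "r x y" if "\<not> b x y" "x \<in> V" "y \<in> V" "x \<noteq> y" for x y using that r_or_b by blast
  consider (odd) k where "Suc m = 2 * k"
    | (even_red) k where "m = 2 * k" "\<And>w w'. w \<in> W \<Longrightarrow> w' \<in> W \<Longrightarrow> w \<noteq> w' \<Longrightarrow> r w w'"
    | (even_blue) k x y where "m = 2 * k" "x \<in> W" "y \<in> W" "b x y"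
    using even_or_odd rb unfolding W_def by blast
  then show False
  proof cases
    case odd
    have uniform: "b d c" if "c \<in> C" "a \<in> W" "a' \<in> W" "d \<in> W" "a \<noteq> a'" "b a c" "b a' c" for c a a' d
    proof (rule ccontr)
      assume "\<not> b d c"
      have "has_cycle b (2 * Suc (k - 1))"
      proof (rule cycle_of_uneven_vertex[OF b_symp dis _ _ _ that \<open>\<not> b d c\<close>])
        show "k - 1 \<le> card {c \<in> C. b w c \<and> b w' c}" if "w \<in> W" "w' \<in> W" "w \<noteq> w'" for w w'
          using common(1)[OF that] odd by linarith
      qed (use odd m q in auto)
      then show False using nob[of "2 * Suc (k - 1)"] odd m by simp
    qed
    have "m \<le> 2 * card T"
      unfolding T_def C_def
      by (rule all_blue_cycle_vertices(1)[OF f m _ Wf W3]) (rule nor uniform[unfolded C_def]; assumption)+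
    then have "has_cycle b (2 * k)"
      using odd m q T by (intro complete_bipartite_even_cycle[OF b_symp, of k W T]) (auto simp: T_def)
    then show False using nob[of "2 * k"] odd by simp
  next
    case even_red
    have uniform: "b d c" if "c \<in> C" "a \<in> W" "a' \<in> W" "d \<in> W" "a \<noteq> a'" "b a c" "b a' c" for c a a' d
    proof (rule ccontr)
      assume "\<not> b d c"
      have "has_cycle b (2 * Suc k)"
      proof (rule cycle_of_uneven_vertex[OF b_symp dis _ _ _ that \<open>\<not> b d c\<close>])
        show "k \<le> card {c \<in> C. b w c \<and> b w' c}" if "w \<in> W" "w' \<in> W" "w \<noteq> w'" for w w'
          using common(2)[OF that even_red(2)[OF that]] even_red(1) by linarith
      qed (use even_red m q in auto)
      then show False using nob[of "2 * Suc k"] even_red m by simp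
    qed
    have "2 * m \<le> 3 * card T"
      unfolding T_def C_def
      by (rule all_blue_cycle_vertices(2)[OF f m _ Wf W3])
        (rule nor uniform[unfolded C_def] even_red(2); assumption)+
    then have "has_cycle b (2 * Suc k)"
      using even_red(1) m q T
      by (intro complete_bipartite_even_cycle[OF b_symp, of "Suc k" W T]) (auto simp: T_def)
    then show False using nob[of "2 * Suc k"] even_red(1) by simp
  next
    case even_blue
    have k: "2 \<le> k" "k + 2 \<le> card W" using even_blue m q by auto
    have finW: "finite W" using finite_V by (simp add: W_def)
    have xy: "x \<noteq> y" using even_blue(4) b_edge by blast
    have no: "\<not> has_cycle b (Suc (2 * k))" using nob even_blue(1) by simp
    have common': "k \<le> Suc (card {c \<in> C. b w c \<and> b w' c})" if "w \<in> W" "w' \<in> W" "w \<noteq> w'" for w w'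
      using common(1)[OF that] even_blue(1) by linarith
    have k1: "1 \<le> k" using k by simp
    have along: "b w c"
      if "distinct ws" "length ws = Suc k" "set ws \<subseteq> W" "b (last ws) (hd ws)"
        "c \<in> C" "i < k" "b (ws ! i) c" "b (ws ! Suc i) c" "w \<in> set ws" for ws c i w
      by (rule common_neighbours_along_path(1)[OF b_symp dis k1 _ that(1-4) no that(5-9)])
        (rule common'; assumption)
    have along_card: "card {c \<in> C. b (ws ! 0) c \<and> b (ws ! 1) c} < k"
      if "distinct ws" "length ws = Suc k" "set ws \<subseteq> W" "b (last ws) (hd ws)" for ws
      by (rule common_neighbours_along_path(2)[OF b_symp dis k1 _ that no])
        (rule common'; assumption)
    have path: "\<exists>ws. distinct ws \<and> length ws = Suc k \<and> set ws \<subseteq> W \<and> ws ! 0 = p \<and> ws ! 1 = p' \<and> hd ws = p \<and> last ws = p''"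
      if p: "p \<in> W" "p' \<in> W" "p'' \<in> W" "p \<noteq> p'" "p \<noteq> p''" "p' \<noteq> p''" for p p' p''
    proof -
      have "card (W - {p, p', p''}) = card W - 3" using p finW by (simp add: card_Diff_subset)
      then have "k - 2 \<le> card (W - {p, p', p''})" using k by linarith
      then obtain zs where "distinct zs" "length zs = k - 2" "set zs \<subseteq> W - {p, p', p''}"
        by (rule obtain_distinct_list)
      then show ?thesis using p k by (intro exI[of _ "p # p' # zs @ [p'']"]) auto
    qed
    have "card (W - {x, y}) \<noteq> 0" using k even_blue xy finW by (simp add: card_Diff_subset)
    then obtain a where a: "a \<in> W" "a \<noteq> x" "a \<noteq> y" by (metis Diff_iff card.empty ex_in_conv insertI1 insertI2)
    \<comment> \<open>Along a path from \<open>x\<close> over \<open>a\<close> to \<open>y\<close> all steps have the same common neighbours, fewer than \<open>k\<close>, so two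
      consecutive vertices \<open>c\<close>, \<open>c'\<close> of the cycle are not among them. Each of \<open>x\<close> and \<open>a\<close>
      is joined in blue to exactly one of these, and not to the same one. This makes \<open>x a\<close>
      another blue edge that can close a path, one whose steps have different common neighbours.\<close>
    obtain ws where ws: "distinct ws" "length ws = Suc k" "set ws \<subseteq> W" "ws ! 0 = x" "ws ! 1 = a"
      "hd ws = x" "last ws = y"
      using path[of x a y] a even_blue xy by auto
    have close: "b (last ws) (hd ws)" using ws even_blue(4) b_sym by simp
    have few: "card {c \<in> C. b x c \<and> b a c} < k" using along_card[OF ws(1-3) close] ws(4,5) by simp
    obtain i where i: "\<not> (b x (f i) \<and> b a (f i))" "\<not> (b x (f (i + 1)) \<and> b a (f (i + 1)))"
    proof -
      let ?s = "\<lambda>i. (i + 1) mod int m"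
      define N where "N = {i \<in> {0..<int m}. \<not> (b x (f i) \<and> b a (f i))}"
      have N: "N \<subseteq> {0..<int m}" by (auto simp: N_def)
      have "{c \<in> C. b x c \<and> b a c} = f ` ({0..<int m} - N)"
        by (auto simp: N_def C_def range_winding[OF f])
      then have "card {c \<in> C. b x c \<and> b a c} = card ({0..<int m} - N)"
        by (simp add: card_image inj_on_subset[OF inj_on_window[OF f, of 0]])
      then have "k < card N"
        using few card_mono[OF _ N] finite_subset[OF N] even_blue(1) N by (simp add: card_Diff_subset)
      then have "card (N \<inter> ?s ` N) \<noteq> 0" using cyclic_shift_card(3)[OF N] m even_blue(1) by simp
      then have "N \<inter> ?s ` N \<noteq> {}" by force
      then obtain j where j: "j \<in> N" "?s j \<in> N" by blast
      have "f (?s j) = f (j + 1)" by (rule winding_cong[OF f]) simp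
      then show thesis using j that[of j] by (auto simp: N_def)
    qed
    have blue1: "b w (f i) \<or> b w (f (i + 1))" if "w \<in> W" for w
      using outside_blue_neighbour[OF f m nor, of w i] that by (auto simp: W_def C_def)
    have not_both: "\<not> (r w c \<and> r w c')" if "w \<in> W" "{c, c'} = {f i, f (i + 1)}" for w c c'
      using blue1[OF that(1)] that(2) not_r_b by (auto simp: doubleton_eq_iff)
    obtain c c' where c: "{c, c'} = {f i, f (i + 1)}" "b x c" "\<not> b a c" "\<not> b x c'" "b a c'"
      using i blue1[OF even_blue(2)] blue1[OF a(1)] by (metis insert_commute)
    have cC: "c \<in> C" "c' \<in> C" using c(1) by (auto simp: C_def doubleton_eq_iff)
    have rW: "r w d" if "\<not> b w d" "w \<in> W" "d \<in> C" for w d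
      using rb[OF that(1)] that(2,3) CV by (auto simp: W_def)
    have ra: "r a c" "r x c'" using rW c cC a even_blue by blast+
    have "\<not> r x a"
    proof
      assume "r x a"
      have "has_cycle r (m + 2)"
        using c(1) detour_cycle[OF f, of "[x, a]" 1 i "m + 2"] detour_cycle[OF f, of "[a, x]" 1 i "m + 2"]
          \<open>r x a\<close> ra r_sym m a even_blue(2) by (auto simp: doubleton_eq_iff W_def C_def)
      then show False using nor by simp
    qed
    then have bxa: "b a x" using rb[of a x] a even_blue b_sym r_sym by (auto simp: W_def)
    \<comment> \<open>The vertex after \<open>a\<close> on the path behaves like \<open>x\<close>: otherwise \<open>c'\<close> would be a common neighbour of a step.\<close>
    define v where "v = ws ! 2"
    have v: "v \<in> W" "v \<noteq> x" "v \<noteq> a"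
    proof -
      have "2 < length ws" using ws(2) k by simp
      then show "v \<in> W" using ws(3) nth_mem[of 2 ws] by (auto simp: v_def)
      show "v \<noteq> x" "v \<noteq> a"
        using ws(1,2,4,5) k nth_eq_iff_index_eq[OF ws(1), of 2 0] nth_eq_iff_index_eq[OF ws(1), of 2 1]
        by (auto simp: v_def)
    qed
    have "x \<in> set ws" using ws(2,4) nth_mem[of 0 ws] by simp
    then have "\<not> b v c'"
      using along[OF ws(1-3) close, of c' 1 x] c cC ws(5) k by (auto simp: v_def numeral_2_eq_2)
    then have "b v c" using not_both[OF v(1) c(1)] rW v cC by blast
    obtain ws' where ws': "distinct ws'" "length ws' = Suc k" "set ws' \<subseteq> W" "ws' ! 0 = x" "ws' ! 1 = v"
      "hd ws' = x" "last ws' = a"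
      using path[of x v a] a v even_blue by auto
    have close': "b (last ws') (hd ws')" using ws' bxa by simp
    have "ws' \<noteq> []" using ws'(2) by auto
    then have "a \<in> set ws'" using ws'(7) last_in_set by metis
    then have "b a c"
      using along[OF ws'(1-3) close', of c 0 a] ws'(4,5) c(2) \<open>b v c\<close> cC k by simp
    then show False using c by simp
  qed
qed

end

section \<open>Monochromatic cycles of length at least \<open>n\<close>\<close>

context two_colouring
begin

text \<open>Without a monochromatic cycle of length 4, two vertices outside the triangle have at most one
  common blue neighbour on it, and each has at most one red one. So any three outer vertices have exactly one red
  neighbour each, all different. A red edge between two of them would close a red cycle of length 4, so they
  form a blue triangle, and this together with a blue common neighbour of two of them contains a blue cycle of length 4.\<close>

lemma four_cycle_from_triangle:
  assumes hc: "has_cycle r 3" and big: "6 \<le> card V"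
  shows "has_cycle r 4 \<or> has_cycle b 4"
proof (rule ccontr)
  assume neg: "\<not> ?thesis"
  have no: False if "is_cycle r [w, x, y, z] \<or> is_cycle b [w, x, y, z]" for w x y z
    using that neg has_cycleI[of r "[w, x, y, z]" 4] has_cycleI[of b "[w, x, y, z]" 4] by auto
  obtain c1 c2 c3 where c: "c1 \<noteq> c2" "c1 \<noteq> c3" "c2 \<noteq> c3" "r c1 c2" "r c2 c3" "r c3 c1"
    using hc by (auto simp: has_cycle_def is_cycle_def numeral_3_eq_3 length_Suc_conv)
  define T where "T = {c1, c2, c3}"
  have T: "r x y" if "x \<in> T" "y \<in> T" "x \<noteq> y" for x y
    using that c r_sym by (auto simp: T_def)
  have TV: "T \<subseteq> V" using c r_edge by (auto simp: T_def)
  have cT: "card T = 3" using c by (simp add: T_def)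
  have third: "\<exists>z\<in>T. z \<noteq> x \<and> z \<noteq> y" for x y using c by (auto simp: T_def)
  have "3 \<le> card (V - T)" using big cT TV by (simp add: card_Diff_subset T_def)
  then obtain w1 w2 w3 where w: "w1 \<in> V - T" "w2 \<in> V - T" "w3 \<in> V - T" "w1 \<noteq> w2" "w1 \<noteq> w3" "w2 \<noteq> w3"
    by (rule obtain_three)
  have red_one: "x = y" if v: "v \<in> V - T" and xy: "x \<in> T" "y \<in> T" "r v x" "r v y" for v x y
  proof (rule ccontr)
    assume ne: "x \<noteq> y"
    obtain z where z: "z \<in> T" "z \<noteq> x" "z \<noteq> y" using third by blast
    have "is_cycle r [v, x, z, y]"
      using v xy z ne T[of x z] T[of z y] r_sym by (auto simp: is_cycle_def)
    then show False using no by blast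
  qed
  have blue_one: "x = y"
    if v: "v \<in> V - T" "v' \<in> V - T" "v \<noteq> v'" and xy: "x \<in> T" "y \<in> T" "b v x" "b v y" "b v' x" "b v' y"
    for v v' x y
  proof (rule ccontr)
    assume ne: "x \<noteq> y"
    have "is_cycle b [v, x, v', y]" using v xy ne b_sym by (auto simp: is_cycle_def)
    then show False using no by blast
  qed
  have rb: "r v x \<or> b v x" if "v \<in> V - T" "x \<in> T" for v x using r_or_b[of v x] that TV by auto
  have ex: "\<exists>d\<in>T. r v d" if v: "v \<in> V - T" for v
  proof (rule ccontr)
    assume n: "\<not> ?thesis"
    have "\<exists>v'\<in>V - T. v' \<noteq> v" using w by metis
    then obtain v' where v': "v' \<in> V - T" "v' \<noteq> v" by blast
    have "\<exists>x\<in>T. \<exists>y\<in>T. x \<noteq> y \<and> b v' x \<and> b v' y"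
      using red_one[OF v'(1)] rb[OF v'(1)] c unfolding T_def by (metis insertI1 insertI2)
    then show False using blue_one[OF v v'(1) v'(2)[symmetric]] n rb[OF v] by blast
  qed
  obtain d1 where d1: "d1 \<in> T" "r w1 d1" using ex w by blast
  obtain d2 where d2: "d2 \<in> T" "r w2 d2" using ex w by blast
  obtain d3 where d3: "d3 \<in> T" "r w3 d3" using ex w by blast
  have differ: "d \<noteq> d'" if v: "v \<in> V - T" "v' \<in> V - T" "v \<noteq> v'" and d: "d \<in> T" "r v d" "d' \<in> T" "r v' d'" for v v' d d'
  proof
    assume "d = d'"
    obtain z where z: "z \<in> T" "z \<noteq> d" using third by blast
    obtain y where y: "y \<in> T" "y \<noteq> d" "y \<noteq> z" using third by blast
    have "b v z" "b v y" "b v' z" "b v' y"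
      using red_one[OF v(1) d(1) _ d(2)] red_one[OF v(2) d(3) _ d(4)] z y rb v \<open>d = d'\<close> by blast+
    then show False using blue_one[OF v z(1) y(1)] y by blast
  qed
  have dd: "d1 \<noteq> d2" "d1 \<noteq> d3" "d2 \<noteq> d3"
    using differ[OF w(1,2,4) d1 d2] differ[OF w(1,3,5) d1 d3] differ[OF w(2,3,6) d2 d3] by blast+
  have blue: "b v v'" if v: "v \<in> V - T" "v' \<in> V - T" "v \<noteq> v'" and d: "d \<in> T" "r v d" "d' \<in> T" "r v' d'" for v v' d d'
  proof (rule ccontr)
    assume "\<not> b v v'"
    then have "r v v'" using r_or_b[of v v'] v by blast
    then have "is_cycle r [v, d, d', v']"
      using v d differ[OF v d] T[of d d'] r_sym by (auto simp: is_cycle_def)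
    then show False using no by blast
  qed
  have "b w1 d3" using red_one[OF w(1) d1(1) d3(1) d1(2)] dd rb[OF w(1) d3(1)] by blast
  moreover have "b w2 d3" using red_one[OF w(2) d2(1) d3(1) d2(2)] dd rb[OF w(2) d3(1)] by blast
  moreover have "b w2 w3" "b w3 w1"
    using blue[OF w(2,3,6) d2 d3] blue[OF w(1,3,5) d1 d3] b_sym by blast+
  ultimately have "is_cycle b [w1, d3, w2, w3]"
    using w d3 b_sym by (auto simp: is_cycle_def)
  then show False using no by blast
qed

lemma triangle_from_red_degree:
  assumes "3 \<le> card {x. r v x}"
  shows "has_cycle r 3 \<or> has_cycle b 3"
proof -
  obtain x y z where x: "r v x" "r v y" "r v z" "x \<noteq> y" "x \<noteq> z" "y \<noteq> z"
    using obtain_three[OF assms] by blast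
  have tri: "has_cycle E 3" if "E p q" "E q s" "E s p" "p \<noteq> q" "p \<noteq> s" "q \<noteq> s" for E :: "'a \<Rightarrow> 'a \<Rightarrow> bool" and p q s
    by (rule has_cycleI[of _ "[p, q, s]"]) (use that in \<open>auto simp: is_cycle_def\<close>)
  have V: "v \<in> V" "x \<in> V" "y \<in> V" "z \<in> V" "v \<noteq> x" "v \<noteq> y" "v \<noteq> z" using x r_edge by blast+
  show ?thesis
  proof (cases "r x y \<or> r y z \<or> r z x")
    case True
    then show ?thesis using tri[of r v] x V r_sym by metis
  next
    case False
    then have "b x y" "b y z" "b z x" using r_or_b V x by blast+
    then show ?thesis using tri[of b x y z] x by blast
  qed
qed

lemma monochromatic_four_cycle:
  assumes big: "6 \<le> card V"
  shows "has_cycle r 4 \<or> has_cycle b 4"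
proof -
  interpret s: two_colouring V b r by (rule colours_swapped)
  obtain v where v: "v \<in> V" using big by fastforce
  have sub: "V - {v} \<subseteq> {x. r v x} \<union> {x. b v x}" using r_or_b v by blast
  have fin: "finite {x. r v x}" "finite {x. b v x}"
    using r_edge b_edge by (auto intro: finite_subset[OF _ finite_V])
  have "card (V - {v}) \<le> card {x. r v x} + card {x. b v x}"
    using card_mono[OF _ sub] card_Un_le[of "{x. r v x}" "{x. b v x}"] fin by simp
  then have "3 \<le> card {x. r v x} \<or> 3 \<le> card {x. b v x}" using v big finite_V by simp linarith
  then have "has_cycle r 3 \<or> has_cycle b 3"
    using triangle_from_red_degree s.triangle_from_red_degree by blast
  then show ?thesis using four_cycle_from_triangle s.four_cycle_from_triangle big by blast
qed

lemma long_monochromatic_cycle: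
  assumes "4 \<le> n" "3 * n \<le> 2 * card V"
  shows "\<exists>m\<ge>n. has_cycle r m \<or> has_cycle b m"
  using assms
proof (induction n rule: nat_induct_at_least)
  case base
  then show ?case using monochromatic_four_cycle by (intro exI[of _ 4]) auto
next
  case (Suc n)
  interpret s: two_colouring V b r by (rule colours_swapped)
  obtain m where m: "n \<le> m" "has_cycle r m \<or> has_cycle b m" using Suc by auto
  show ?case
  proof (cases "m = n")
    case True
    then obtain M where "n < M" "has_cycle r M \<or> has_cycle b M"
      using m(2) longer_monochromatic_cycle[of n] s.longer_monochromatic_cycle[of n] Suc by auto
    then show ?thesis by (meson Suc_leI)
  qed (use m in \<open>auto intro!: exI[of _ m]\<close>)
qed

definition extremal :: "nat \<Rightarrow> ('a \<Rightarrow> 'a \<Rightarrow> bool) \<Rightarrow> ('a \<Rightarrow> 'a \<Rightarrow> bool) \<Rightarrow> bool" where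
  "extremal n E F \<longleftrightarrow> (\<exists>u U1 U2. u \<in> V \<and> V = U1 \<union> U2 \<union> {u} \<and> U1 \<inter> U2 = {} \<and> u \<notin> U1 \<and> u \<notin> U2 \<and>
     clique E U1 \<and> clique E U2 \<and> (\<forall>x\<in>U1. \<forall>y\<in>U2. F x y) \<and> card U1 \<le> card U2 \<and> card U2 < n)"

text \<open>The length \<open>m\<close> is the least one not below \<open>n\<close> for which there is a monochromatic cycle. It is not odd,
  since odd cycles can be shortened by one vertex. If it is \<open>2 l\<close>, there are two blue cliques with \<open>l\<close> vertices
  each, essentially complete in red to each other. They contain a red cycle of length \<open>2 l - 2\<close>, so
  \<open>2 l - 2 < n < 2 l\<close>: the length \<open>n\<close> is odd, and the cliques, up to one vertex, are the core of the extremal structure.\<close>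

lemma extremal_of_shortest_red_cycle:
  assumes n: "5 \<le> n" "3 * n \<le> 2 * card V" and hc: "has_cycle r m" "n \<le> m"
    and least: "\<And>k. n \<le> k \<Longrightarrow> k < m \<Longrightarrow> \<not> has_cycle r k \<and> \<not> has_cycle b k"
    and no: "\<not> has_cycle r n" "\<not> has_cycle b n"
  shows "extremal n b r"
proof -
  have nm: "n < m" using hc no by (cases "n = m") auto
  have no': "\<not> has_cycle r (m - 1)" "\<not> has_cycle b (m - 1)" using least[of "m - 1"] nm by auto
  have "even m"
  proof (rule ccontr)
    assume "odd m"
    moreover have "7 \<le> m" using \<open>odd m\<close> nm n by presburger
    ultimately show False using odd_cycle_step[OF hc(1)] no' by blast
  qed
  then obtain l where l: "m = 2 * l" by blast
  have l3: "3 \<le> l" using l nm n by simp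
  obtain X Y where XY: "clique b X" "clique b Y" "X \<inter> Y = {}" "card X = l" "card Y = l"
    using even_cycle_two_blue_cliques[of l] hc(1) l l3 no' by metis
  obtain X' Y' where X': "clique b X'" "clique b Y'" "X' \<inter> Y' = {}" "card X' = l - 1" "card Y' = l"
    and red: "\<And>x y. x \<in> X' \<Longrightarrow> y \<in> Y' \<Longrightarrow> r x y"
    using red_between_blue_cliques[OF XY(1,4,2,5,3) l3] no' l by metis
  have "has_cycle r (2 * (l - 1))"
    by (rule complete_bipartite_even_cycle[OF r_symp _ _ _ X'(3) red]) (use X' l3 in auto)
  then have "\<not> n \<le> 2 * (l - 1)" using least[of "2 * (l - 1)"] l l3 by auto
  then have nl: "n = 2 * l - 1" using nm l by linarith
  have big: "3 * l - 1 \<le> card V" using n nl l3 by linarith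
  obtain u U1 U2 where U: "u \<in> V" "V = U1 \<union> U2 \<union> {u}" "U1 \<inter> U2 = {}" "u \<notin> U1" "u \<notin> U2"
    "clique b U1" "clique b U2" "\<And>x y. x \<in> U1 \<Longrightarrow> y \<in> U2 \<Longrightarrow> r x y"
    "card U1 < n" "card U2 < n"
    using extremal_structure_of_bipartite_core[OF X'(1,4,2,5,3) red l3 big] no nl by metis
  show ?thesis
  proof (cases "card U1 \<le> card U2")
    case True
    then show ?thesis unfolding extremal_def using U by blast
  next
    case False
    have "r y x" if "x \<in> U1" "y \<in> U2" for x y using U(8) that r_sym by blast
    moreover have "V = U2 \<union> U1 \<union> {u}" "U2 \<inter> U1 = {}" "card U2 \<le> card U1" using U(2,3) False by auto
    ultimately show ?thesis unfolding extremal_def using U(1,4-7,9,10) by blast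
  qed
qed

lemma extremal_colouring:
  assumes n: "4 \<le> n" "3 * n \<le> 2 * card V" and no: "\<not> has_cycle r n" "\<not> has_cycle b n"
  shows "extremal n b r \<or> extremal n r b"
proof -
  interpret s: two_colouring V b r by (rule colours_swapped)
  have "n \<noteq> 4" using monochromatic_four_cycle no n by auto
  then have n5: "5 \<le> n" using n by simp
  define P where "P m \<longleftrightarrow> n \<le> m \<and> (has_cycle r m \<or> has_cycle b m)" for m
  have "\<exists>m. P m" using long_monochromatic_cycle[OF n] by (auto simp: P_def)
  then have P: "P (LEAST m. P m)" by (rule LeastI_ex)
  define m where "m = (LEAST m. P m)"
  have least: "\<not> has_cycle r k \<and> \<not> has_cycle b k" if "n \<le> k" "k < m" for k
    using not_less_Least[of k P] that by (auto simp: m_def P_def)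
  have m: "n \<le> m" "has_cycle r m \<or> has_cycle b m" using P by (auto simp: m_def P_def)
  have "extremal n b r" if "has_cycle r m"
    by (rule extremal_of_shortest_red_cycle[OF n5 n(2) that m(1) _ no]) (rule least)
  moreover have "extremal n r b" if "has_cycle b m"
    by (rule s.extremal_of_shortest_red_cycle[OF n5 n(2) that m(1) _ no(2,1)]) (use least in blast)
  ultimately show ?thesis using m by blast
qed

end

section \<open>Graphs and their colourings\<close>

lemma contains_cycle_graph:
  assumes "simple_graph G" "has_cycle (\<lambda>x y. {x, y} \<in> edges G) n"
  shows "contains_copy G (cycle_graph n)"
proof -
  obtain xs where xs: "length xs = n" "3 \<le> n" "distinct xs"
    "successively (\<lambda>x y. {x, y} \<in> edges G) xs" "{last xs, hd xs} \<in> edges G"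
    using assms(2) by (auto simp: has_cycle_def is_cycle_def)
  have ne: "xs \<noteq> []" using xs by auto
  define F where "F = {{xs ! i, xs ! (Suc i mod n)} | i. i < n}"
  have e: "{xs ! i, xs ! (Suc i mod n)} \<in> edges G" if "i < n" for i
  proof (cases "Suc i < n")
    case True
    then show ?thesis using xs by (auto simp: successively_conv_nth)
  next
    case False
    then have "Suc i = n" using that by simp
    moreover have "i = n - 1" using calculation by simp
    ultimately show ?thesis using xs ne by (simp add: last_conv_nth hd_conv_nth)
  qed
  have G: "edges G \<subseteq> [verts G]\<^bsup>2\<^esup>" using assms(1) by (simp add: simple_graph_def)
  have nth_verts: "xs ! i \<in> verts G" if "i < n" for i using subsetD[OF G e[OF that]] by simp
  have "F \<subseteq> [set xs]\<^bsup>2\<^esup>"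
  proof
    fix y assume "y \<in> F"
    then obtain i where i: "i < n" "y = {xs ! i, xs ! (Suc i mod n)}" by (auto simp: F_def)
    have "xs ! i \<noteq> xs ! (Suc i mod n)" using subsetD[OF G e[OF i(1)]] by auto
    moreover have "Suc i mod n < n" using xs(2) by simp
    ultimately show "y \<in> [set xs]\<^bsup>2\<^esup>" using i xs(1) by simp
  qed
  moreover have "set xs \<subseteq> verts G" using nth_verts xs(1) by (auto simp: in_set_conv_nth)
  moreover have "F \<subseteq> edges G" using e by (auto simp: F_def)
  ultimately have "subgraph (set xs, F) G" by (simp add: subgraph_def simple_graph_def)
  moreover have "graph_iso (cycle_graph n) (set xs, F)"
    unfolding graph_iso_def
  proof (intro exI[of _ "nth xs"] conjI)
    show "bij_betw ((!) xs) (verts (cycle_graph n)) (verts (set xs, F))"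
      using xs by (auto simp: cycle_graph_def intro: bij_betw_nth)
    show "edges (set xs, F) = (\<lambda>e. (!) xs ` e) ` edges (cycle_graph n)"
      by (auto simp: cycle_graph_def F_def image_def)
  qed
  ultimately show ?thesis by (auto simp: contains_copy_def)
qed

lemma two_colouring_of_coloring:
  assumes "finite V" "two_coloring (complete_graph V) R B"
  shows "two_colouring V (\<lambda>x y. {x, y} \<in> edges R) (\<lambda>x y. {x, y} \<in> edges B)"
proof -
  have e: "[V]\<^bsup>2\<^esup> = edges R \<union> edges B" "edges R \<inter> edges B = {}"
    using assms(2) by (auto simp: two_coloring_def complete_graph_def)
  have iff: "{x, y} \<in> edges R \<or> {x, y} \<in> edges B \<longleftrightarrow> x \<in> V \<and> y \<in> V \<and> x \<noteq> y" for x y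
    using e(1) doubleton_in_nsets_2[of x y V] by auto
  show ?thesis
    by unfold_locales
      (use assms(1) iff e(2) in \<open>auto simp: symp_def insert_commute\<close>)
qed

lemma delete_vertex_edges_of_cliques:
  assumes col: "two_coloring (complete_graph V) R B"
    and U: "V = U1 \<union> U2 \<union> {u}" "U1 \<inter> U2 = {}" "u \<notin> U1" "u \<notin> U2"
    and cl: "\<And>x y. x \<in> U1 \<Longrightarrow> y \<in> U1 \<Longrightarrow> x \<noteq> y \<Longrightarrow> {x, y} \<in> edges R"
      "\<And>x y. x \<in> U2 \<Longrightarrow> y \<in> U2 \<Longrightarrow> x \<noteq> y \<Longrightarrow> {x, y} \<in> edges R"
    and cross: "\<And>x y. x \<in> U1 \<Longrightarrow> y \<in> U2 \<Longrightarrow> {x, y} \<in> edges B"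
  shows "edges (delete_vertex R u) = [U1]\<^bsup>2\<^esup> \<union> [U2]\<^bsup>2\<^esup>"
    and "edges (delete_vertex B u) = edges_between U1 U2"
proof -
  have e: "[V]\<^bsup>2\<^esup> = edges R \<union> edges B" "edges R \<inter> edges B = {}"
    using col by (auto simp: two_coloring_def complete_graph_def)
  have split: "e \<in> [U1]\<^bsup>2\<^esup> \<union> [U2]\<^bsup>2\<^esup> \<or> e \<in> edges_between U1 U2" if "e \<in> edges R \<union> edges B" "u \<notin> e" for e
  proof -
    have "e \<in> [V]\<^bsup>2\<^esup>" using that e by blast
    then obtain x y where xy: "e = {x, y}" "x \<in> V" "y \<in> V" "x \<noteq> y" by (auto simp: nsets_2_eq)
    then show ?thesis using that(2) U by (auto simp: edges_between_def doubleton_eq_iff)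
  qed
  have red: "[U1]\<^bsup>2\<^esup> \<union> [U2]\<^bsup>2\<^esup> \<subseteq> edges R" using cl by (auto simp: nsets_2_eq)
  have blue: "edges_between U1 U2 \<subseteq> edges B" using cross by (auto simp: edges_between_def)
  have u: "u \<notin> e" if "e \<in> [U1]\<^bsup>2\<^esup> \<union> [U2]\<^bsup>2\<^esup> \<union> edges_between U1 U2" for e
    using that U by (auto simp: nsets_2_eq edges_between_def)
  show "edges (delete_vertex R u) = [U1]\<^bsup>2\<^esup> \<union> [U2]\<^bsup>2\<^esup>"
    using split red blue u e(2) unfolding delete_vertex_def snd_conv by blast
  show "edges (delete_vertex B u) = edges_between U1 U2"
    using split red blue u e(2) unfolding delete_vertex_def snd_conv by blast
qed

theorem theorem2:
  fixes n p :: nat and \<beta> :: real and V :: "'a set" and R B :: "'a graph"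
  assumes "n \<ge> 4"
    and "0 < \<beta>" and "\<beta> \<le> of_int \<lfloor>real n / 2\<rfloor> / real n"
    and "p = nat \<lfloor>(2 - \<beta>) * real n\<rfloor>"
    and "finite V" and "card V = p"
    and "two_coloring (complete_graph V) R B"
    and "\<not> contains_copy R (cycle_graph n)" and "\<not> contains_copy B (cycle_graph n)"
  shows "\<exists>u U1 U2.
    u \<in> V \<and> V = U1 \<union> U2 \<union> {u} \<and> U1 \<inter> U2 = {} \<and> u \<notin> U1 \<and> u \<notin> U2 \<and>
    (1 - \<beta>) * real n - 1 < real (card U1) \<and> card U1 \<le> card U2 \<and> card U2 < n \<and>
    up_to_color (\<lambda>R B.
      edges (delete_vertex R u) = [U1]\<^bsup>2\<^esup> \<union> [U2]\<^bsup>2\<^esup> \<and>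
      edges (delete_vertex B u) = edges_between U1 U2) R B"
proof -
  interpret two_colouring V "\<lambda>x y. {x, y} \<in> edges R" "\<lambda>x y. {x, y} \<in> edges B"
    by (rule two_colouring_of_coloring[OF assms(5,7)])
  have col': "two_coloring (complete_graph V) B R"
    using assms(7) by (auto simp: two_coloring_def)
  have simple: "simple_graph R" "simple_graph B" using assms(7) by (auto simp: two_coloring_def)
  have n0: "0 < real n" using assms(1) by simp
  have "\<beta> * real n \<le> of_int \<lfloor>real n / 2\<rfloor>" using assms(3) n0 by (simp add: pos_le_divide_eq)
  also have "\<lfloor>real n / 2\<rfloor> = int (n div 2)" by (metis floor_divide_of_nat_eq of_nat_numeral)
  finally have "real_of_int (2 * int n - int (n div 2)) \<le> (2 - \<beta>) * real n"
    by (simp add: algebra_simps)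
  then have "2 * int n - int (n div 2) \<le> \<lfloor>(2 - \<beta>) * real n\<rfloor>" by (simp only: le_floor_iff)
  then have "2 * int n - int (n div 2) \<le> int p" using assms(4) by linarith
  then have large: "3 * n \<le> 2 * card V" using assms(6) by linarith
  have p_gt: "(2 - \<beta>) * real n - 1 < real p" using assms(4) by linarith
  have finish: ?thesis
    if ext: "extremal n (\<lambda>x y. {x, y} \<in> edges S) (\<lambda>x y. {x, y} \<in> edges T)"
      and ST: "two_coloring (complete_graph V) S T" "(S, T) = (R, B) \<or> (S, T) = (B, R)" for S T
  proof -
    obtain u U1 U2 where U: "u \<in> V" "V = U1 \<union> U2 \<union> {u}" "U1 \<inter> U2 = {}" "u \<notin> U1" "u \<notin> U2"
      "clique (\<lambda>x y. {x, y} \<in> edges S) U1" "clique (\<lambda>x y. {x, y} \<in> edges S) U2"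
      "\<forall>x\<in>U1. \<forall>y\<in>U2. {x, y} \<in> edges T" "card U1 \<le> card U2" "card U2 < n"
      using ext unfolding extremal_def by blast
    have fin: "finite U1" "finite U2" using U(2) assms(5) by (metis finite_Un)+
    have "card V = card (insert u (U1 \<union> U2))" using U(2) by simp
    also have "\<dots> = Suc (card U1 + card U2)" using U fin by (simp add: card_Un_disjoint)
    finally have "real p < real (card U1) + real n + 1" using assms(6) U(10) by linarith
    \<comment> \<open>As \<open>U2\<close> has fewer than \<open>n\<close> vertices, \<open>U1\<close> has at least \<open>p - n\<close>.\<close>
    then have "p \<le> card U1 + n" by linarith
    then have "real p \<le> real (card U1) + real n" by linarith
    then have bound: "(1 - \<beta>) * real n - 1 < real (card U1)" using p_gt by (simp add: algebra_simps)
    have "edges (delete_vertex S u) = [U1]\<^bsup>2\<^esup> \<union> [U2]\<^bsup>2\<^esup>" "edges (delete_vertex T u) = edges_between U1 U2"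
      using delete_vertex_edges_of_cliques[OF ST(1) U(2-5) cliqueD[OF U(6)] cliqueD[OF U(7)]] U(8) by blast+
    then have "up_to_color (\<lambda>R B. edges (delete_vertex R u) = [U1]\<^bsup>2\<^esup> \<union> [U2]\<^bsup>2\<^esup> \<and>
      edges (delete_vertex B u) = edges_between U1 U2) R B"
      using ST(2) by (auto simp: up_to_color_def)
    then show ?thesis using U(1-5,9,10) bound by blast
  qed
  have "\<not> has_cycle (\<lambda>x y. {x, y} \<in> edges R) n" "\<not> has_cycle (\<lambda>x y. {x, y} \<in> edges B) n"
    using contains_cycle_graph simple assms(8,9) by blast+
  from extremal_colouring[OF assms(1) large this] show ?thesis
    using finish[of B R] finish[of R B] assms(7) col' by blast
qed

end
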